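(* Let $\alpha>-1$, $i\in\mathbb{S}$, let $J$ be the unitary anti-selfadjoint operator $Jf=\operatorname{ext}(if_i)$ on $\mathcal{A}^2_{\alpha,i}(\mathbb{D})$, and let $T\in\mathcal{B}_J(\mathcal{A}^2_{\alpha,i}(\mathbb{D}))$. Then $$|\widetilde{T}(z)-\widetilde{T}(w)|\le 2\sqrt{2+\alpha}\,\|T\|\,\rho(z,w)\quad\text{for all }z,w\in\mathbb{D}_i,$$ where $\rho(z,w)=\frac{|z-w|}{|1-z\overline{w}|}$ is the pseudo-hyperbolic metric between $z$ and $w$. Furthermore, the Lipschitz constant $2\sqrt{2+\alpha}$ is sharp, i.e. it cannot be replaced by a smaller constant valid for all $T\in\mathcal{B}_J(\mathcal{A}^2_{\alpha,i}(\mathbb{D}))$ and all $z,w\in\mathbb{D}_i$.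
   Context: $\mathbb{H}$ denotes the quaternions, $\mathbb{D}$ its open unit ball, $\mathbb{S}=\{x\in\mathbb{H}:\operatorname{Re}(x)=0,\ |x|=1\}$, $\mathbb{C}_i=\{a+ib:a,b\in\mathbb{R}\}$, $\mathbb{D}_i=\mathbb{D}\cap\mathbb{C}_i$, and $dm_i$ is Lebesgue measure on $\mathbb{C}_i$. Every $x\in\mathbb{H}$ is written $x=x_0+i_xx_1$ with $x_0=\operatorname{Re}(x)$, $x_1$ the modulus of the imaginary part, $i_x\in\mathbb{S}$. A real differentiable $f:\mathbb{D}\to\mathbb{H}$ is left slice hyperholomorphic if $f(x)=u(x_0,x_1)+i_xv(x_0,x_1)$ with $\mathbb{H}$-valued $u,v$ satisfying $u(x_0,x_1)=u(x_0,-x_1)$, $v(x_0,x_1)=-v(x_0,-x_1)$, $\partial_{x_0}u=\partial_{x_1}v$ and $\partial_{x_0}v=-\partial_{x_1}u$. $dA_{\alpha,i}(z)=\frac{\alpha+1}{\pi}(1-|z|^2)^\alpha dm_i(z)$ on $\mathbb{D}_i$. $\mathcal{A}^2_{\alpha,i}(\mathbb{D})$ is the right $\mathbb{H}$-vector space of all left slice hyperholomorphic $f$ on $\mathbb{D}$ with $\int_{\mathbb{D}_i}|f|^2dA_{\alpha,i}<\infty$, with scalar product $\langle f,g\rangle=\int_{\mathbb{D}_i}\overline{f(z)}g(z)\,dA_{\alpha,i}(z)$; it is a quaternionic reproducing kernel Hilbert space. $K_w$ denotes the unique element with $f(w)=\langle K_w,f\rangle$ for all $f$ (for $z,w\in\mathbb{D}_i$,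 $K_w(z)=(1-z\overline w)^{-(2+\alpha)}$), $k_w=K_w/\|K_w\|$, and the Berezin transform of $T$ is $\widetilde{T}(z)=\langle k_z,Tk_z\rangle$, $z\in\mathbb{D}_i$. $f_i=f|_{\mathbb{D}_i}$, and $\operatorname{ext}(if_i)$ is the unique left slice hyperholomorphic function on $\mathbb{D}$ whose restriction to $\mathbb{D}_i$ is $z\mapsto if(z)$. $\mathcal{B}_J(\mathcal{A}^2_{\alpha,i}(\mathbb{D}))$ is the set of bounded right $\mathbb{H}$-linear operators commuting with $J$, and $\|T\|$ is the operator norm. *)

theory Defs
  imports "HOL-Analysis.Analysis"
begin

section \<open>Quaternions\<close>

datatype quat = Quat (qre: real) (qim1: real) (qim2: real) (qim3: real)

lemma quat_eq_iff:
  "x = y \<longleftrightarrow> qre x = qre y \<and> qim1 x = qim1 y \<and> qim2 x = qim2 y \<and> qim3 x = qim3 y"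
  by (cases x; cases y) auto

instantiation quat :: ab_group_add
begin

definition "0 = Quat 0 0 0 0"

definition "x + y = Quat (qre x + qre y) (qim1 x + qim1 y) (qim2 x + qim2 y) (qim3 x + qim3 y)"

definition "- x = Quat (- qre x) (- qim1 x) (- qim2 x) (- qim3 x)"

definition "x - y = Quat (qre x - qre y) (qim1 x - qim1 y) (qim2 x - qim2 y) (qim3 x - qim3 y)"

instance
  by standard (auto simp: quat_eq_iff zero_quat_def plus_quat_def uminus_quat_def minus_quat_def)

end

lemma quat_zero_sel [simp]: "qre 0 = 0" "qim1 0 = 0" "qim2 0 = 0" "qim3 0 = 0"
  by (simp_all add: zero_quat_def)

lemma quat_add_sel [simp]:
  "qre (x + y) = qre x + qre y" "qim1 (x + y) = qim1 x + qim1 y"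
  "qim2 (x + y) = qim2 x + qim2 y" "qim3 (x + y) = qim3 x + qim3 y"
  by (simp_all add: plus_quat_def)

lemma quat_uminus_sel [simp]:
  "qre (- x) = - qre x" "qim1 (- x) = - qim1 x" "qim2 (- x) = - qim2 x" "qim3 (- x) = - qim3 x"
  by (simp_all add: uminus_quat_def)

lemma quat_minus_sel [simp]:
  "qre (x - y) = qre x - qre y" "qim1 (x - y) = qim1 x - qim1 y"
  "qim2 (x - y) = qim2 x - qim2 y" "qim3 (x - y) = qim3 x - qim3 y"
  by (simp_all add: minus_quat_def)

instantiation quat :: ring_1
begin

definition "1 = Quat 1 0 0 0"

definition "x * y = Quat
  (qre x * qre y - qim1 x * qim1 y - qim2 x * qim2 y - qim3 x * qim3 y)
  (qre x * qim1 y + qim1 x * qre y + qim2 x * qim3 y - qim3 x * qim2 y)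
  (qre x * qim2 y - qim1 x * qim3 y + qim2 x * qre y + qim3 x * qim1 y)
  (qre x * qim3 y + qim1 x * qim2 y - qim2 x * qim1 y + qim3 x * qre y)"

instance
  by standard (auto simp: quat_eq_iff one_quat_def times_quat_def algebra_simps)

end

lemma quat_one_sel [simp]: "qre 1 = 1" "qim1 1 = 0" "qim2 1 = 0" "qim3 1 = 0"
  by (simp_all add: one_quat_def)

lemma quat_mult_sel [simp]:
  "qre (x * y) = qre x * qre y - qim1 x * qim1 y - qim2 x * qim2 y - qim3 x * qim3 y"
  "qim1 (x * y) = qre x * qim1 y + qim1 x * qre y + qim2 x * qim3 y - qim3 x * qim2 y"
  "qim2 (x * y) = qre x * qim2 y - qim1 x * qim3 y + qim2 x * qre y + qim3 x * qim1 y"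
  "qim3 (x * y) = qre x * qim3 y + qim1 x * qim2 y - qim2 x * qim1 y + qim3 x * qre y"
  by (simp_all add: times_quat_def)

instantiation quat :: real_algebra_1
begin

definition "r *\<^sub>R x = Quat (r * qre x) (r * qim1 x) (r * qim2 x) (r * qim3 x)"

instance
  by standard (auto simp: quat_eq_iff scaleR_quat_def algebra_simps)

end

lemma quat_scaleR_sel [simp]:
  "qre (r *\<^sub>R x) = r * qre x" "qim1 (r *\<^sub>R x) = r * qim1 x"
  "qim2 (r *\<^sub>R x) = r * qim2 x" "qim3 (r *\<^sub>R x) = r * qim3 x"
  by (simp_all add: scaleR_quat_def)

lemma quat_of_real_sel [simp]:
  "qre (of_real r) = r" "qim1 (of_real r) = 0" "qim2 (of_real r) = 0" "qim3 (of_real r) = 0"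
  by (simp_all add: of_real_def)

definition qcnj :: "quat \<Rightarrow> quat" where
  "qcnj x = Quat (qre x) (- qim1 x) (- qim2 x) (- qim3 x)"

lemma qcnj_sel [simp]:
  "qre (qcnj x) = qre x" "qim1 (qcnj x) = - qim1 x"
  "qim2 (qcnj x) = - qim2 x" "qim3 (qcnj x) = - qim3 x"
  by (simp_all add: qcnj_def)

instantiation quat :: real_inner
begin

definition "inner x y = qre x * qre y + qim1 x * qim1 y + qim2 x * qim2 y + qim3 x * qim3 y"

definition "norm (x :: quat) = sqrt (inner x x)"

definition "sgn (x :: quat) = x /\<^sub>R norm x"

definition "dist (x :: quat) y = norm (x - y)"

definition
  "(uniformity :: (quat \<times> quat) filter) = (INF e\<in>{0<..}. principal {(x, y). dist x y < e})"

definition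
  "open (U :: quat set) \<longleftrightarrow> (\<forall>x\<in>U. eventually (\<lambda>(x', y). x' = x \<longrightarrow> y \<in> U) uniformity)"

instance
proof
  fix x y z :: quat and r :: real and U :: "quat set"
  show "inner x y = inner y x"
    by (simp add: inner_quat_def algebra_simps)
  show "inner (x + y) z = inner x z + inner y z"
    by (simp add: inner_quat_def algebra_simps)
  show "inner (r *\<^sub>R x) y = r * inner x y"
    by (simp add: inner_quat_def algebra_simps)
  show "0 \<le> inner x x"
    by (simp add: inner_quat_def)
  show "inner x x = 0 \<longleftrightarrow> x = 0"
    by (simp add: inner_quat_def quat_eq_iff add_nonneg_eq_0_iff)
qed (rule norm_quat_def sgn_quat_def dist_quat_def uniformity_quat_def open_quat_def)+

end

instantiation quat :: real_normed_div_algebra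
begin

definition "inverse x = qcnj x /\<^sub>R inner x x" for x :: quat

definition "x div y = x * inverse y" for x y :: quat

instance
proof
  fix x y :: quat
  show "x \<noteq> 0 \<Longrightarrow> inverse x * x = 1" "x \<noteq> 0 \<Longrightarrow> x * inverse x = 1"
  proof -
    assume "x \<noteq> 0"
    then have nz: "inner x x \<noteq> 0" by simp
    have "qcnj x * x = inner x x *\<^sub>R 1" "x * qcnj x = inner x x *\<^sub>R 1"
      by (auto simp: quat_eq_iff inner_quat_def)
    with nz show "inverse x * x = 1" "x * inverse x = 1"
      by (simp_all add: inverse_quat_def)
  qed
  show "x div y = x * inverse y" by (rule divide_quat_def)
  show "inverse (0 :: quat) = 0" by (simp add: inverse_quat_def quat_eq_iff)
  have "inner (x * y) (x * y) = inner x x * inner y y"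
    by (simp add: inner_quat_def) algebra
  then show "norm (x * y) = norm x * norm y"
    by (simp add: norm_quat_def real_sqrt_mult)
qed

end

instantiation quat :: euclidean_space
begin

definition "Basis = {Quat 1 0 0 0, Quat 0 1 0 0, Quat 0 0 1 0, Quat 0 0 0 1}"

instance
proof
  fix x :: quat
  show "(\<forall>u\<in>Basis. inner x u = 0) \<longleftrightarrow> x = 0"
    unfolding Basis_quat_def by (simp add: inner_quat_def) (auto simp: quat_eq_iff)
qed (auto simp: Basis_quat_def inner_quat_def)

end

section \<open>Slice hyperholomorphic functions on the unit ball\<close>

definition qSphere :: "quat set" where
  "qSphere = {x. qre x = 0 \<and> norm x = 1}"

definition qDisc :: "quat set" where
  "qDisc = ball 0 1"

definition qslice :: "quat \<Rightarrow> quat set" where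
  "qslice i = {of_real a + i * of_real b | a b. True}"

definition slice_disc :: "quat \<Rightarrow> quat set" where
  "slice_disc i = qDisc \<inter> qslice i"

definition qImv :: "quat \<Rightarrow> quat" where
  "qImv x = x - of_real (qre x)"

text \<open>For real \<open>x\<close> the unit \<open>I\<close> below is an arbitrary element of the sphere. The partial
  derivatives of \<open>u\<close> and \<open>v\<close> are only constrained on the unit disc of the plane, where
  they are determined by \<open>f\<close>.\<close>

definition slice_hyperholomorphic :: "(quat \<Rightarrow> quat) \<Rightarrow> bool" where
  "slice_hyperholomorphic f \<longleftrightarrow> f differentiable_on qDisc \<and>
    (\<exists>u v :: real \<Rightarrow> real \<Rightarrow> quat.
      (\<forall>x\<in>qDisc. \<forall>I\<in>qSphere. x = of_real (qre x) + I * of_real (norm (qImv x)) \<longrightarrow>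
         f x = u (qre x) (norm (qImv x)) + I * v (qre x) (norm (qImv x))) \<and>
      (\<forall>a b. a\<^sup>2 + b\<^sup>2 < 1 \<longrightarrow>
         u a b = u a (- b) \<and> v a b = - v a (- b) \<and>
         (\<exists>p q. ((\<lambda>t. u t b) has_vector_derivative p) (at a) \<and>
                ((\<lambda>t. v a t) has_vector_derivative p) (at b) \<and>
                ((\<lambda>t. v t b) has_vector_derivative q) (at a) \<and>
                ((\<lambda>t. u a t) has_vector_derivative (- q)) (at b))))"

text \<open>Functions on the unit ball are represented by functions on all quaternions that
  vanish off the ball, so that equality of functions on the ball is HOL equality.\<close>

definition slice_hyp_functions :: "(quat \<Rightarrow> quat) set" where
  "slice_hyp_functions = {f. slice_hyperholomorphic f \<and> (\<forall>x. x \<notin> qDisc \<longrightarrow> f x = 0)}"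

text \<open>The unique slice hyperholomorphic extension; only \<open>h\<close> on \<open>slice_disc i\<close> matters.\<close>

definition slice_ext :: "quat \<Rightarrow> (quat \<Rightarrow> quat) \<Rightarrow> quat \<Rightarrow> quat" where
  "slice_ext i h = (THE g. g \<in> slice_hyp_functions \<and> (\<forall>z\<in>slice_disc i. g z = h z))"

section \<open>Weighted Bergman spaces\<close>

text \<open>Lebesgue measure on the slice, as a measure on the quaternions.\<close>

definition slice_lborel :: "quat \<Rightarrow> quat measure" where
  "slice_lborel i =
    distr (lborel :: complex measure) borel (\<lambda>z. of_real (Re z) + i * of_real (Im z))"

definition bergman_measure :: "real \<Rightarrow> quat \<Rightarrow> quat measure" where
  "bergman_measure \<alpha> i = density (slice_lborel i)
    (\<lambda>z. ennreal (indicator (slice_disc i) z * ((\<alpha> + 1) / pi * (1 - (norm z)\<^sup>2) powr \<alpha>)))"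

definition bergman_space :: "real \<Rightarrow> quat \<Rightarrow> (quat \<Rightarrow> quat) set" where
  "bergman_space \<alpha> i =
    {f \<in> slice_hyp_functions. integrable (bergman_measure \<alpha> i) (\<lambda>z. (norm (f z))\<^sup>2)}"

definition bergman_inner :: "real \<Rightarrow> quat \<Rightarrow> (quat \<Rightarrow> quat) \<Rightarrow> (quat \<Rightarrow> quat) \<Rightarrow> quat" where
  "bergman_inner \<alpha> i f g = integral\<^sup>L (bergman_measure \<alpha> i) (\<lambda>z. qcnj (f z) * g z)"

text \<open>The scalar product of \<open>f\<close> with itself is a nonnegative real number.\<close>

definition bergman_norm :: "real \<Rightarrow> quat \<Rightarrow> (quat \<Rightarrow> quat) \<Rightarrow> real" where
  "bergman_norm \<alpha> i f = sqrt (qre (bergman_inner \<alpha> i f f))"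

definition bergman_kernel :: "real \<Rightarrow> quat \<Rightarrow> quat \<Rightarrow> quat \<Rightarrow> quat" where
  "bergman_kernel \<alpha> i w = (THE K. K \<in> bergman_space \<alpha> i \<and>
     (\<forall>f\<in>bergman_space \<alpha> i. f w = bergman_inner \<alpha> i K f))"

definition normalized_kernel :: "real \<Rightarrow> quat \<Rightarrow> quat \<Rightarrow> quat \<Rightarrow> quat" where
  "normalized_kernel \<alpha> i w =
    (\<lambda>x. bergman_kernel \<alpha> i w x /\<^sub>R bergman_norm \<alpha> i (bergman_kernel \<alpha> i w))"

section \<open>Operators\<close>

text \<open>Operators are HOL functions on all of \<open>quat \<Rightarrow> quat\<close>; only their values on the
  Bergman space are relevant.\<close>

type_synonym qoperator = "(quat \<Rightarrow> quat) \<Rightarrow> (quat \<Rightarrow> quat)"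

definition bounded_right_linear :: "real \<Rightarrow> quat \<Rightarrow> qoperator \<Rightarrow> bool" where
  "bounded_right_linear \<alpha> i T \<longleftrightarrow>
    (\<forall>f\<in>bergman_space \<alpha> i. T f \<in> bergman_space \<alpha> i) \<and>
    (\<forall>f\<in>bergman_space \<alpha> i. \<forall>g\<in>bergman_space \<alpha> i. T (\<lambda>x. f x + g x) = (\<lambda>x. T f x + T g x)) \<and>
    (\<forall>f\<in>bergman_space \<alpha> i. \<forall>q. T (\<lambda>x. f x * q) = (\<lambda>x. T f x * q)) \<and>
    (\<exists>M. \<forall>f\<in>bergman_space \<alpha> i. bergman_norm \<alpha> i (T f) \<le> M * bergman_norm \<alpha> i f)"

definition operator_norm :: "real \<Rightarrow> quat \<Rightarrow> qoperator \<Rightarrow> real" where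
  "operator_norm \<alpha> i T =
    (SUP f\<in>{f \<in> bergman_space \<alpha> i. bergman_norm \<alpha> i f \<le> 1}. bergman_norm \<alpha> i (T f))"

definition opJ :: "quat \<Rightarrow> qoperator" where
  "opJ i f = slice_ext i (\<lambda>z. i * f z)"

definition bounded_ops_J :: "real \<Rightarrow> quat \<Rightarrow> qoperator set" where
  "bounded_ops_J \<alpha> i =
    {T. bounded_right_linear \<alpha> i T \<and> (\<forall>f\<in>bergman_space \<alpha> i. T (opJ i f) = opJ i (T f))}"

definition berezin :: "real \<Rightarrow> quat \<Rightarrow> qoperator \<Rightarrow> quat \<Rightarrow> quat" where
  "berezin \<alpha> i T z =
    bergman_inner \<alpha> i (normalized_kernel \<alpha> i z) (T (normalized_kernel \<alpha> i z))"

definition pseudo_hyp_dist :: "quat \<Rightarrow> quat \<Rightarrow> real" where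
  "pseudo_hyp_dist z w = norm (z - w) / norm (1 - z * qcnj w)"

end

theory Submission
  imports Defs "HOL-Complex_Analysis.Complex_Analysis"
begin

text \<open>Left holomorphic functions on the slice disc extend uniquely to the ball, and composing with
  the complex functionals \<open>x \<mapsto> slice_proj i (x * q)\<close> turns them into holomorphic functions. The
  reproducing property of the kernel thus reduces to the complex weighted Bergman space, where it
  follows from orthogonality of monomials (rotation invariance) and a Beta integral.

  In the Hilbert space, \<open>T\<close> commuting with \<open>J\<close> makes \<open>\<langle>k\<^sub>w, T k\<^sub>w\<rangle>\<close> commute with the slice, so \<open>k\<^sub>w\<close> may be
  rotated until \<open>\<langle>k\<^sub>z, k\<^sub>w\<rangle>\<close> is real; polarization then bounds the difference of the Berezin transforms
  by \<open>2 \<parallel>T\<parallel> sqrt (1 - \<bar>\<langle>k\<^sub>z, k\<^sub>w\<rangle>\<bar>\<^sup>2)\<close>, where \<open>\<bar>\<langle>k\<^sub>z, k\<^sub>w\<rangle>\<bar>\<^sup>2 = (1 - \<rho>\<^sup>2) powr (\<alpha> + 2)\<close>, and Bernoulli's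
  inequality finishes. Sharpness is seen at the origin on the operator that swaps the orthonormal
  vectors \<open>1\<close> and \<open>sqrt (\<alpha> + 2) x\<close>.\<close>

section \<open>Lebesgue measure on the complex plane\<close>

text \<open>For unit vectors x and y, |x - y|^2 |x + y|^2 = 4 (1 - (Re <x, y>)^2): polarization sees
  only the real part of the scalar product, whereas \<rho> is governed by its modulus. The gap is
  closed by replacing k_w with k_w q, |q| = 1, but over the quaternions this conjugates <k_w, T k_w>
  by q. The q that is needed lies in the slice of i, and the Berezin value survives because it
  commutes with that slice; this is where J enters the estimate. The number 2 + \<alpha> under the
  root is the exponent of the kernel: the coefficient of \<rho>^2 in 1 - (1 - \<rho>^2) powr
  (\<alpha> + 2) at first order. Sharpness asks for equality, to first order, in both Cauchy-Schwarz
  steps of the polarization. For z = r small and w = 0, k_r + k_0 is close to 2, and k_r - k_0 to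
  (\<alpha> + 2) r x, which is r sqrt (\<alpha> + 2) times a unit vector. Equality then wants T to
  send the directions of 1 and x to each other, hence the swap.\<close>

lemma measurable_Complex [measurable]:
  assumes [measurable]: "f \<in> borel_measurable M" "g \<in> borel_measurable M"
  shows "(\<lambda>x. Complex (f x) (g x)) \<in> borel_measurable M"
proof -
  have "(\<lambda>x. complex_of_real (f x) + \<i> * complex_of_real (g x)) \<in> borel_measurable M"
    by measurable
  thus ?thesis by (simp only: Complex_eq)
qed

lemma lborel_complex_eq_distr:
  "(lborel :: complex measure) = distr (lborel \<Otimes>\<^sub>M lborel) borel (\<lambda>(x, y). Complex x y)"
proof (rule lborel_eqI)
  fix l u :: complex
  assume le: "\<And>b. b \<in> Basis \<Longrightarrow> l \<bullet> b \<le> u \<bullet> b"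
  have "Re l \<le> Re u" "Im l \<le> Im u"
    using le[of 1] le[of \<i>] by (auto simp: Basis_complex_def)
  have [measurable]: "(\<lambda>(x, y). Complex x y) \<in> borel_measurable (lborel \<Otimes>\<^sub>M lborel)"
    unfolding case_prod_beta by measurable
  have eq: "(\<lambda>(x, y). Complex x y) -` box l u \<inter> space (lborel \<Otimes>\<^sub>M lborel) = {Re l<..<Re u} \<times> {Im l<..<Im u}"
    by (auto simp: space_pair_measure in_box_complex_iff)
  have "emeasure (distr (lborel \<Otimes>\<^sub>M lborel) borel (\<lambda>(x, y). Complex x y)) (box l u)
      = ennreal ((Re u - Re l) * (Im u - Im l))"
    using \<open>Re l \<le> Re u\<close> \<open>Im l \<le> Im u\<close>
    by (subst emeasure_distr) (simp_all add: eq lborel.emeasure_pair_measure_Times ennreal_mult)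
  also have "(Re u - Re l) * (Im u - Im l) = (\<Prod>b\<in>Basis. (u - l) \<bullet> b)"
    by (simp add: Basis_complex_def)
  finally show "emeasure (distr (lborel \<Otimes>\<^sub>M lborel) borel (\<lambda>(x, y). Complex x y)) (box l u)
      = ennreal (\<Prod>b\<in>Basis. (u - l) \<bullet> b)" .
qed simp

lemma nn_integral_complex_iterated:
  assumes [measurable]: "f \<in> borel_measurable borel"
  shows "(\<integral>\<^sup>+ z. f z \<partial>lborel) = (\<integral>\<^sup>+ x. \<integral>\<^sup>+ y. f (Complex x y) \<partial>lborel \<partial>lborel)"
    "(\<integral>\<^sup>+ z. f z \<partial>lborel) = (\<integral>\<^sup>+ y. \<integral>\<^sup>+ x. f (Complex x y) \<partial>lborel \<partial>lborel)"
proof -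
  have "(\<integral>\<^sup>+ z. f z \<partial>lborel) = (\<integral>\<^sup>+ p. f (Complex (fst p) (snd p)) \<partial>(lborel \<Otimes>\<^sub>M lborel))"
    by (subst lborel_complex_eq_distr, subst nn_integral_distr) (auto simp: case_prod_beta)
  then show "(\<integral>\<^sup>+ z. f z \<partial>lborel) = (\<integral>\<^sup>+ x. \<integral>\<^sup>+ y. f (Complex x y) \<partial>lborel \<partial>lborel)"
    "(\<integral>\<^sup>+ z. f z \<partial>lborel) = (\<integral>\<^sup>+ y. \<integral>\<^sup>+ x. f (Complex x y) \<partial>lborel \<partial>lborel)"
    using lborel.nn_integral_fst[of "\<lambda>p. f (Complex (fst p) (snd p))" "lborel :: real measure"]
      lborel_pair.nn_integral_snd[of "\<lambda>p. f (Complex (fst p) (snd p))"]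
    by simp_all
qed

lemma nn_integral_real_shift:
  assumes [measurable]: "f \<in> borel_measurable borel"
  shows "(\<integral>\<^sup>+ x. f (x + c) \<partial>lborel) = (\<integral>\<^sup>+ (x::real). f x \<partial>lborel)"
  using nn_integral_real_affine[of f 1 c] by (simp add: add.commute)

text \<open>On each horizontal or vertical line a shear is a translation. The order of iterated
  integration is chosen so that the translated variable is the inner one.\<close>

lemma nn_integral_shear:
  assumes [measurable]: "f \<in> borel_measurable borel"
  shows "(\<integral>\<^sup>+ z. f (Complex (Re z + t * Im z) (Im z)) \<partial>lborel) = (\<integral>\<^sup>+ z. f z \<partial>lborel)"
    "(\<integral>\<^sup>+ z. f (Complex (Re z) (Im z + t * Re z)) \<partial>lborel) = (\<integral>\<^sup>+ z. f z \<partial>lborel)"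
proof -
  show "(\<integral>\<^sup>+ z. f (Complex (Re z + t * Im z) (Im z)) \<partial>lborel) = (\<integral>\<^sup>+ z. f z \<partial>lborel)"
    by (subst (1 2) nn_integral_complex_iterated(2), simp_all)
       (subst nn_integral_real_shift[of "\<lambda>x. f (Complex x _)"], simp_all)
  show "(\<integral>\<^sup>+ z. f (Complex (Re z) (Im z + t * Re z)) \<partial>lborel) = (\<integral>\<^sup>+ z. f z \<partial>lborel)"
    by (subst (1 2) nn_integral_complex_iterated(1), simp_all)
       (subst nn_integral_real_shift[of "\<lambda>y. f (Complex _ y)"], simp_all)
qed

text \<open>A rotation by an angle other than \<open>\<pi>\<close> is a product of three shears.\<close>

lemma nn_integral_rotate:
  assumes [measurable]: "f \<in> borel_measurable borel" and \<theta>: "\<bar>\<theta>\<bar> < pi"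
  shows "(\<integral>\<^sup>+ z. f (cis \<theta> * z) \<partial>lborel) = (\<integral>\<^sup>+ z. f z \<partial>lborel)"
proof -
  \<comment> \<open>Two horizontal shears with this parameter enclose a vertical one with parameter
    \<open>sin \<theta>\<close>. The half angle stays inside (-pi/2, pi/2), so the tangent is a
    genuine one; \<open>e1\<close> and \<open>e2\<close> are the matrix entries of the
    product.\<close>
  define t where "t = - tan (\<theta> / 2)"
  have c: "cos (\<theta> / 2) \<noteq> 0"
    using \<theta> cos_gt_zero_pi[of "\<theta> / 2"] by (simp add: abs_less_iff)
  have sc: "sin \<theta> = 2 * sin (\<theta> / 2) * cos (\<theta> / 2)" "cos \<theta> = 1 - 2 * (sin (\<theta> / 2))\<^sup>2"
    using sin_double[of "\<theta> / 2"] cos_double_sin[of "\<theta> / 2"] by auto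
  have e1: "1 + t * sin \<theta> = cos \<theta>"
    unfolding sc t_def tan_def using c by (simp add: power2_eq_square)
  have "1 + cos \<theta> = 2 * (cos (\<theta> / 2))\<^sup>2"
    using cos_double_cos[of "\<theta> / 2"] by simp
  then have "t * (1 + cos \<theta>) = - sin \<theta>"
    using c by (simp add: sc(1) t_def tan_def power2_eq_square)
  then have e2: "t + t * cos \<theta> = - sin \<theta>"
    by (simp add: algebra_simps)
  have eq: "cis \<theta> * z = Complex (Re z + t * Im z + t * (Im z + sin \<theta> * (Re z + t * Im z)))
      (Im z + sin \<theta> * (Re z + t * Im z))" for z
  proof (rule complex_eqI)
    have "Re z + t * Im z + t * (Im z + sin \<theta> * (Re z + t * Im z))
      = (1 + t * sin \<theta>) * Re z + (t + t * (1 + t * sin \<theta>)) * Im z"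
      by (simp add: algebra_simps)
    also have "\<dots> = cos \<theta> * Re z - sin \<theta> * Im z"
      by (simp only: e1 e2 minus_mult_left diff_conv_add_uminus)
    also have "\<dots> = Re (cis \<theta> * z)" by simp
    finally show "Re (cis \<theta> * z) = Re (Complex (Re z + t * Im z + t * (Im z + sin \<theta> * (Re z + t * Im z)))
      (Im z + sin \<theta> * (Re z + t * Im z)))" by (simp only: complex.sel)
    have "Im z + sin \<theta> * (Re z + t * Im z) = sin \<theta> * Re z + (1 + t * sin \<theta>) * Im z"
      by (simp add: algebra_simps)
    also have "\<dots> = Im (cis \<theta> * z)" by (simp only: e1) simp
    finally show "Im (cis \<theta> * z) = Im (Complex (Re z + t * Im z + t * (Im z + sin \<theta> * (Re z + t * Im z)))
      (Im z + sin \<theta> * (Re z + t * Im z)))" by (simp only: complex.sel)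
  qed
  have "(\<integral>\<^sup>+ z. f (cis \<theta> * z) \<partial>lborel) =
      (\<integral>\<^sup>+ z. f (Complex (Re z + t * (Im z + sin \<theta> * Re z)) (Im z + sin \<theta> * Re z)) \<partial>lborel)"
    unfolding eq by (subst (2) nn_integral_shear(1)[symmetric, of _ t]) simp_all
  also have "\<dots> = (\<integral>\<^sup>+ z. f (Complex (Re z + t * Im z) (Im z)) \<partial>lborel)"
    by (subst (2) nn_integral_shear(2)[symmetric, of _ "sin \<theta>"]) simp_all
  also have "\<dots> = (\<integral>\<^sup>+ z. f z \<partial>lborel)"
    by (rule nn_integral_shear(1)) simp
  finally show ?thesis .
qed

section \<open>Distribution of the squared modulus on the unit disc\<close>

lemma emeasure_disc:
  assumes "0 \<le> r"
  shows "emeasure lborel (ball (0::complex) r) = ennreal (pi * r\<^sup>2)"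
    "emeasure lborel (cball (0::complex) r) = ennreal (pi * r\<^sup>2)"
  using assms by (simp_all add: emeasure_ball emeasure_cball unit_ball_vol_2)

text \<open>The disc of squared radius t has area pi t, so |z|^2 is uniformly distributed with
  density pi. This replaces polar coordinates for integrands that depend on |z| only.\<close>

lemma distr_norm_sq:
  "distr (density lborel (indicator (ball (0::complex) 1))) borel (\<lambda>z. (norm z)\<^sup>2)
    = density lborel (\<lambda>t. ennreal (pi * indicator {0..1} t))" (is "?M = ?N")
proof (rule measure_eqI_lessThan)
  fix x :: real
  \<comment> \<open>\<open>min 1 (max 0 x)\<close> clamps x to the unit interval, so that a single
    formula covers tails that start below 0 or above 1.\<close>
  have N: "emeasure ?N {x<..} = ennreal (pi * (1 - min 1 (max 0 x)))"
  proof -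
    have "emeasure ?N {x<..} = (\<integral>\<^sup>+ t. ennreal pi * indicator ({x<..} \<inter> {0..1}) t \<partial>lborel)"
      by (subst emeasure_density) (auto intro!: nn_integral_cong split: split_indicator)
    also have "\<dots> = ennreal pi * emeasure lborel ({x<..} \<inter> {0..1})"
      by (rule nn_integral_cmult_indicator) simp
    also have "emeasure lborel ({x<..} \<inter> {0..1}) = ennreal (1 - min 1 (max 0 x))"
    proof (cases "x < 0")
      case True
      then have "{x<..} \<inter> {0..1} = {0..1}" by auto
      then show ?thesis using True by simp
    next
      case False
      then have "{x<..} \<inter> {0..1} = {x<..1}" by auto
      then show ?thesis using False by (cases "x \<le> 1") (auto simp: max_def min_def)
    qed
    finally show ?thesis by (simp add: ennreal_mult)
  qed
  have M: "emeasure ?M {x<..} = ennreal (pi * (1 - min 1 (max 0 x)))"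
  proof -
    have [measurable]: "indicator (ball (0::complex) 1) \<in> borel_measurable borel"
      by (rule borel_measurable_indicator) simp
    have "emeasure ?M {x<..} = emeasure (density lborel (indicator (ball (0::complex) 1))) {z. x < (norm z)\<^sup>2}"
      by (subst emeasure_distr) (auto simp: vimage_def)
    also have "\<dots> = (\<integral>\<^sup>+ z. indicator (ball (0::complex) 1) z * indicator {z. x < (norm z)\<^sup>2} z \<partial>lborel)"
      by (subst emeasure_density) (auto intro!: borel_measurable_indicator)
    also have "\<dots> = (\<integral>\<^sup>+ z. indicator (ball (0::complex) 1 \<inter> {z. x < (norm z)\<^sup>2}) z \<partial>lborel)"
      by (intro nn_integral_cong) (auto simp: indicator_def)
    also have "\<dots> = emeasure lborel (ball (0::complex) 1 \<inter> {z. x < (norm z)\<^sup>2})"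
      by (rule nn_integral_indicator) simp
    also have "\<dots> = ennreal (pi * (1 - min 1 (max 0 x)))"
    proof (cases "x < 0")
      case True
      then have "ball (0::complex) 1 \<inter> {z. x < (norm z)\<^sup>2} = ball 0 1"
        by (auto intro: less_le_trans)
      with True show ?thesis by (simp add: emeasure_disc)
    next
      case False
      have "norm z \<le> sqrt x \<longleftrightarrow> (norm z)\<^sup>2 \<le> x" for z :: complex
        using real_sqrt_le_iff[of "(norm z)\<^sup>2" x] by simp
      then have eq: "ball (0::complex) 1 \<inter> {z. x < (norm z)\<^sup>2} = ball 0 1 - cball 0 (sqrt x)"
        by (auto simp: not_le)
      show ?thesis
      proof (cases "x < 1")
        case True
        then have "cball (0::complex) (sqrt x) \<subseteq> ball 0 1"
          using False by (simp add: cball_subset_ball_iff)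
        then have "emeasure lborel (ball (0::complex) 1 - cball 0 (sqrt x))
            = ennreal (pi * 1\<^sup>2) - ennreal (pi * (sqrt x)\<^sup>2)"
          using False by (subst emeasure_Diff) (simp_all add: emeasure_disc)
        also have "\<dots> = ennreal (pi * (1 - x))"
          using False by (subst ennreal_minus) (simp_all add: algebra_simps)
        finally show ?thesis using True False by (simp add: eq)
      next
        case F: False
        then have "ball (0::complex) 1 \<subseteq> cball 0 (sqrt x)"
          by (simp add: ball_subset_cball_iff)
        then have "ball (0::complex) 1 - cball 0 (sqrt x) = {}" by auto
        then show ?thesis using F unfolding eq by (simp only: emeasure_empty) simp
      qed
    qed
    finally show ?thesis .
  qed
  show "emeasure ?M {x<..} = emeasure ?N {x<..}" "emeasure ?M {x<..} < \<infinity>"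
    unfolding M N by simp_all
qed auto

section \<open>The complex weighted Bergman kernel\<close>

definition disc_weight :: "real \<Rightarrow> complex \<Rightarrow> real" where
  "disc_weight \<alpha> z = indicator (ball 0 1) z * ((\<alpha> + 1) / pi * (1 - (norm z)\<^sup>2) powr \<alpha>)"

text \<open>The same measure for every i: the Bergman measure on a slice is its image under the
  embedding of the complex plane, see \<open>bergman_measure_eq\<close>.\<close>

definition disc_measure :: "real \<Rightarrow> complex measure" where
  "disc_measure \<alpha> = density lborel (\<lambda>z. ennreal (disc_weight \<alpha> z))"

lemma sets_disc_measure [simp, measurable_cong]: "sets (disc_measure \<alpha>) = sets borel"
  and space_disc_measure [simp]: "space (disc_measure \<alpha>) = UNIV"
  by (simp_all add: disc_measure_def)

lemma disc_weight_measurable [measurable]: "disc_weight \<alpha> \<in> borel_measurable borel"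
proof -
  have [measurable]: "ball (0::complex) 1 \<in> sets borel" by simp
  show ?thesis unfolding disc_weight_def by measurable
qed

lemma AE_disc_measure: "AE z in disc_measure \<alpha>. norm z < 1"
  unfolding disc_measure_def
  by (subst AE_density) (auto simp: disc_weight_def indicator_def)

text \<open>With t = |z|^2 the integral becomes (\<alpha> + 1) Beta (n + 1) (\<alpha> + 1), the
  reciprocal of the n-th coefficient of (1 - x) powr (- (\<alpha> + 2)). For n = 0 this says that
  the total mass is 1, and n = 1 yields the normalization of \<open>coord\<close>.\<close>

lemma nn_integral_disc_measure_power:
  assumes \<alpha>: "\<alpha> > -1"
  shows "(\<integral>\<^sup>+ z. ennreal ((norm z)\<^sup>2 ^ n) \<partial>disc_measure \<alpha>) = ennreal (fact n / pochhammer (\<alpha> + 2) n)"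
proof -
  define g where "g t = ennreal ((\<alpha> + 1) / pi * (t ^ n * (1 - t) powr \<alpha>))" for t :: real
  have [measurable]: "g \<in> borel_measurable borel" unfolding g_def by measurable
  have [measurable]: "ball (0::complex) 1 \<in> sets borel" by simp
  have [measurable]: "indicator (ball (0::complex) 1) \<in> borel_measurable borel"
    by (rule borel_measurable_indicator) simp
  have "(\<integral>\<^sup>+ z. ennreal ((norm z)\<^sup>2 ^ n) \<partial>disc_measure \<alpha>)
      = (\<integral>\<^sup>+ z. ennreal (disc_weight \<alpha> z) * ennreal ((norm z)\<^sup>2 ^ n) \<partial>lborel)"
    unfolding disc_measure_def by (subst nn_integral_density) auto
  also have "\<dots> = (\<integral>\<^sup>+ z. indicator (ball (0::complex) 1) z * g ((norm z)\<^sup>2) \<partial>lborel)"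
    using \<alpha> by (intro nn_integral_cong)
      (auto simp: disc_weight_def g_def indicator_def mult_ac simp flip: ennreal_mult'')
  also have "\<dots> = (\<integral>\<^sup>+ z. g ((norm z)\<^sup>2) \<partial>density lborel (indicator (ball (0::complex) 1)))"
    by (subst nn_integral_density) auto
  also have "\<dots> = (\<integral>\<^sup>+ t. g t \<partial>distr (density lborel (indicator (ball (0::complex) 1))) borel (\<lambda>z. (norm z)\<^sup>2))"
    by (subst nn_integral_distr) auto
  also have "\<dots> = (\<integral>\<^sup>+ t. ennreal (pi * indicator {0..1} t) * g t \<partial>lborel)"
    unfolding distr_norm_sq by (subst nn_integral_density) auto
  also have "\<dots> = (\<integral>\<^sup>+ t. ennreal ((\<alpha> + 1) * (t powr (real (n + 1) - 1) * (1 - t) powr ((\<alpha> + 1) - 1))) * indicator {0..1} t \<partial>lborel)"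
  \<comment> \<open>The point 0 has to be left out because of n = 0: there \<open>t ^ n\<close> is 1
    but \<open>t powr 0\<close> is 0.\<close>
  proof (intro nn_integral_cong_AE eventually_mono[OF AE_lborel_singleton[of "0::real"]])
    fix t :: real assume "t \<noteq> 0"
    then show "ennreal (pi * indicator {0..1} t) * g t = ennreal ((\<alpha> + 1) * (t powr (real (n + 1) - 1) * (1 - t) powr ((\<alpha> + 1) - 1))) * indicator {0..1} t"
      using \<alpha> by (auto simp: g_def indicator_def powr_realpow simp flip: ennreal_mult'')
  qed
  also have "\<dots> = ennreal ((\<alpha> + 1) * Beta (real (n + 1)) (\<alpha> + 1))"
  proof (rule nn_integral_has_integral_lebesgue')
    show "((\<lambda>t. (\<alpha> + 1) * (t powr (real (n + 1) - 1) * (1 - t) powr (\<alpha> + 1 - 1))) has_integral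
      (\<alpha> + 1) * Beta (real (n + 1)) (\<alpha> + 1)) {0..1}"
      using \<alpha> by (intro has_integral_mult_right has_integral_Beta_real) auto
  qed (use \<alpha> in auto)
  also have "(\<alpha> + 1) * Beta (real (n + 1)) (\<alpha> + 1) = fact n / pochhammer (\<alpha> + 2) n"
  proof -
    have "\<alpha> + 2 \<notin> \<int>\<^sub>\<le>\<^sub>0" "\<alpha> + 1 \<notin> \<int>\<^sub>\<le>\<^sub>0"
      using \<alpha> by (auto elim!: nonpos_Ints_cases)
    then have "pochhammer (\<alpha> + 2) n = Gamma (\<alpha> + 2 + n) / Gamma (\<alpha> + 2)"
      "Gamma (\<alpha> + 2) = (\<alpha> + 1) * Gamma (\<alpha> + 1)" "Gamma (\<alpha> + 2) \<noteq> 0"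
      using \<alpha> Gamma_plus1[of "\<alpha> + 1"] by (auto simp: pochhammer_Gamma add_ac Gamma_eq_zero_iff)
    moreover have "Gamma (real (n + 1)) = fact n" using Gamma_fact[of n, where 'a = real] by (simp add: add.commute)
    moreover have "real (n + 1) + (\<alpha> + 1) = \<alpha> + 2 + n" by simp
    ultimately show ?thesis by (simp only: Beta_def) (simp add: mult_ac)
  qed
  finally show ?thesis .
qed

lemma finite_disc_measure: "\<alpha> > -1 \<Longrightarrow> finite_measure (disc_measure \<alpha>)"
  using nn_integral_disc_measure_power[of \<alpha> 0] by (intro finite_measureI) simp

lemma integral_disc_measure_power:
  assumes \<alpha>: "\<alpha> > -1"
  shows "(\<integral>z. (norm z)\<^sup>2 ^ n \<partial>disc_measure \<alpha>) = fact n / pochhammer (\<alpha> + 2) n"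
  using \<alpha> nn_integral_disc_measure_power[OF \<alpha>, of n]
  by (subst integral_eq_nn_integral) (auto simp: pochhammer_nonneg)

lemma integrable_disc_bounded:
  fixes f :: "complex \<Rightarrow> 'b :: {banach, second_countable_topology}"
  assumes "\<alpha> > -1" "f \<in> borel_measurable borel" "\<And>z. norm z < 1 \<Longrightarrow> norm (f z) \<le> B"
  shows "integrable (disc_measure \<alpha>) f"
  using assms by (intro finite_measure.integrable_const_bound[OF finite_disc_measure, of _ _ B]
      eventually_mono[OF AE_disc_measure]) (auto simp: measurable_def)

section \<open>Rotation invariance and orthogonality of monomials\<close>

lemma distr_disc_measure_rotate:
  assumes "\<bar>\<theta>\<bar> < pi"
  shows "distr (disc_measure \<alpha>) borel (\<lambda>z. cis \<theta> * z) = disc_measure \<alpha>"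
proof (rule measure_eqI)
  fix A :: "complex set"
  assume "A \<in> sets (distr (disc_measure \<alpha>) borel (\<lambda>z. cis \<theta> * z))"
  then have [measurable]: "A \<in> sets borel" by simp
  have A: "{z. cis \<theta> * z \<in> A} \<in> sets borel"
    using measurable_sets[of "\<lambda>z. cis \<theta> * z" borel borel A] by (simp add: vimage_def)
  have "emeasure (distr (disc_measure \<alpha>) borel (\<lambda>z. cis \<theta> * z)) A
      = emeasure (disc_measure \<alpha>) {z. cis \<theta> * z \<in> A}"
    by (subst emeasure_distr) (simp_all add: vimage_def)
  also have "\<dots> = (\<integral>\<^sup>+ z. ennreal (disc_weight \<alpha> z) * indicator {z. cis \<theta> * z \<in> A} z \<partial>lborel)"
    unfolding disc_measure_def using A by (subst emeasure_density) simp_all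
  also have "\<dots> = (\<integral>\<^sup>+ z. ennreal (disc_weight \<alpha> (cis \<theta> * z)) * indicator A (cis \<theta> * z) \<partial>lborel)"
    by (intro nn_integral_cong) (auto simp: disc_weight_def indicator_def norm_mult)
  also have "\<dots> = (\<integral>\<^sup>+ z. ennreal (disc_weight \<alpha> z) * indicator A z \<partial>lborel)"
    by (rule nn_integral_rotate[OF _ assms]) measurable
  also have "\<dots> = emeasure (disc_measure \<alpha>) A"
    unfolding disc_measure_def by (subst emeasure_density) simp_all
  finally show "emeasure (distr (disc_measure \<alpha>) borel (\<lambda>z. cis \<theta> * z)) A = emeasure (disc_measure \<alpha>) A" .
qed simp

lemma measurable_cnj [measurable]: "cnj \<in> borel_measurable borel"
  by (intro borel_measurable_continuous_onI continuous_intros)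

lemma measurable_power_complex [measurable]: "(\<lambda>z::complex. z ^ k) \<in> borel_measurable borel"
  by (intro borel_measurable_continuous_onI continuous_intros)

text \<open>A suitable rotation multiplies the integrand by the imaginary unit while it preserves
  the integral, which must then be 0. The smaller disc is kept because power series are integrated
  termwise only there.\<close>

lemma integral_disc_monomials_orthogonal:
  assumes "n \<noteq> k"
  shows "(\<integral>z. indicator (ball 0 r) z *\<^sub>R (cnj z ^ n * z ^ k) \<partial>disc_measure \<alpha>) = 0" (is "?I = 0")
proof -
  define f where "f z = indicator (ball 0 r) z *\<^sub>R (cnj z ^ n * z ^ k)" for z
  define d where "d = real k - real n"
  \<comment> \<open>Rotation by \<theta> contributes the phase (k - n) \<theta> = pi / 2. Since |k -
    n| is at least 1, \<theta> is within the range of \<open>nn_integral_rotate\<close>.\<close>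
  define \<theta> where "\<theta> = pi / (2 * d)"
  have [measurable]: "ball (0::complex) r \<in> sets borel" by simp
  have [measurable]: "f \<in> borel_measurable borel" unfolding f_def by measurable
  have d: "\<bar>d\<bar> \<ge> 1" using assms unfolding d_def by linarith
  then have "\<bar>\<theta>\<bar> < pi" by (auto simp: \<theta>_def abs_mult field_simps)
  have "d * \<theta> = pi / 2"
    using d by (auto simp: \<theta>_def)
  then have "- (real n * \<theta>) + real k * \<theta> = pi / 2"
    by (simp add: d_def left_diff_distrib)
  then have "cis (- (real n * \<theta>)) * cis (real k * \<theta>) = \<i>"
    by (simp only: cis_mult cis_pi_half)
  then have c: "cnj (cis \<theta>) ^ n * cis \<theta> ^ k = \<i>"
    by (simp only: cis_cnj Complex.DeMoivre mult_minus_right)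
  have "f (cis \<theta> * z) = (cnj (cis \<theta>) ^ n * cis \<theta> ^ k) * f z" for z
    by (simp add: f_def power_mult_distrib norm_mult indicator_def mult_ac)
  then have f: "f (cis \<theta> * z) = \<i> * f z" for z unfolding c .
  have "integral\<^sup>L (disc_measure \<alpha>) f = (\<integral>z. f (cis \<theta> * z) \<partial>disc_measure \<alpha>)"
    by (subst (1) distr_disc_measure_rotate[OF \<open>\<bar>\<theta>\<bar> < pi\<close>, symmetric], subst integral_distr) simp_all
  also have "\<dots> = \<i> * integral\<^sup>L (disc_measure \<alpha>) f"
    unfolding f by simp
  finally have "(1 - \<i>) * integral\<^sup>L (disc_measure \<alpha>) f = 0" by (simp add: algebra_simps)
  then show ?thesis by (auto simp: f_def[abs_def] complex_eq_iff)
qed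

text \<open>Dominated convergence with |g| as the bound. The radii are 1 - 1/(m + 2), starting at
  1/2, so that all of them are positive.\<close>

lemma tendsto_integral_subdiscs:
  fixes g :: "complex \<Rightarrow> complex"
  assumes g: "integrable (disc_measure \<alpha>) g"
  shows "(\<lambda>m. \<integral>z. indicator (ball 0 (1 - inverse (real (Suc (Suc m))))) z *\<^sub>R g z \<partial>disc_measure \<alpha>)
    \<longlonglongrightarrow> integral\<^sup>L (disc_measure \<alpha>) g"
proof (rule integral_dominated_convergence)
  have [measurable]: "ball (0::complex) r \<in> sets borel" for r by simp
  have [measurable]: "g \<in> borel_measurable borel"
    using borel_measurable_integrable[OF g] by (simp add: measurable_def)
  show "g \<in> borel_measurable (disc_measure \<alpha>)" by measurable
  show "(\<lambda>z. indicator (ball 0 (1 - inverse (real (Suc (Suc m))))) z *\<^sub>R g z) \<in> borel_measurable (disc_measure \<alpha>)" for m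
    by measurable
  show "integrable (disc_measure \<alpha>) (\<lambda>z. norm (g z))" using g by simp
  show "AE z in disc_measure \<alpha>. norm (indicator (ball 0 (1 - inverse (real (Suc (Suc m))))) z *\<^sub>R g z) \<le> norm (g z)" for m
    by (auto simp: indicator_def)
  show "AE z in disc_measure \<alpha>. (\<lambda>m. indicator (ball 0 (1 - inverse (real (Suc (Suc m))))) z *\<^sub>R g z) \<longlonglongrightarrow> g z"
  proof (rule eventually_mono[OF AE_disc_measure])
    fix z :: complex assume z: "norm z < 1"
    have "(\<lambda>m. 1 - inverse (real (Suc (Suc m)))) \<longlonglongrightarrow> 1 - 0"
      by (intro tendsto_diff tendsto_const LIMSEQ_Suc[OF LIMSEQ_inverse_real_of_nat])
    then have "\<forall>\<^sub>F m in sequentially. norm z < 1 - inverse (real (Suc (Suc m)))"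
      using z by (intro order_tendstoD) auto
    then have "\<forall>\<^sub>F m in sequentially. indicator (ball 0 (1 - inverse (real (Suc (Suc m))))) z *\<^sub>R g z = g z"
      by eventually_elim simp
    then show "(\<lambda>m. indicator (ball 0 (1 - inverse (real (Suc (Suc m))))) z *\<^sub>R g z) \<longlonglongrightarrow> g z"
      by (rule tendsto_eventually)
  qed
qed

text \<open>Integrability of F alone does not allow its Taylor series to be integrated term by term
  over the unit disc. On a disc of radius r < 1 the series converges uniformly and orthogonality
  leaves the n-th term; then r tends to 1 on both sides, so the moments of the smaller discs need
  not be computed.\<close>

lemma integral_disc_monomial_holomorphic:
  assumes \<alpha>: "\<alpha> > -1" and hol: "F holomorphic_on ball 0 1" and int: "integrable (disc_measure \<alpha>) F"
  shows "(\<integral>z. cnj z ^ n * F z \<partial>disc_measure \<alpha>) = (deriv ^^ n) F 0 / of_real (pochhammer (\<alpha> + 2) n)"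
proof -
  define a where "a k = (deriv ^^ k) F 0 / fact k" for k
  have sums: "(\<lambda>k. a k * z ^ k) sums F z" if "norm z < 1" for z
    using holomorphic_power_series[OF hol, of z] that by (simp add: a_def)
  have [measurable]: "ball (0::complex) r \<in> sets borel" for r by simp
  have [measurable]: "F \<in> borel_measurable borel"
    using borel_measurable_integrable[OF int] by (simp add: measurable_def)
  define J where "J r k = (\<integral>z. indicator (ball 0 r) z *\<^sub>R (cnj z ^ n * z ^ k) \<partial>disc_measure \<alpha>)" for r k
  have part: "(\<integral>z. indicator (ball 0 r) z *\<^sub>R (cnj z ^ n * F z) \<partial>disc_measure \<alpha>) = a n * J r n"
    if r: "0 < r" "r < 1" for r
  proof -
    define f where "f k z = indicator (ball 0 r) z *\<^sub>R (cnj z ^ n * (a k * z ^ k))" for k z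
    have [measurable]: "f k \<in> borel_measurable borel" for k unfolding f_def by measurable
    have bound: "norm (f k z) \<le> norm (a k) * r ^ k" if "norm z < 1" for k z
    proof (cases "norm z < r")
      case True
      have "norm (cnj z ^ n * (a k * z ^ k)) = norm z ^ n * (norm (a k) * norm z ^ k)"
        by (simp add: norm_mult norm_power)
      also have "\<dots> \<le> 1 * (norm (a k) * r ^ k)"
        using that True by (intro mult_mono power_mono mult_left_mono power_le_one) auto
      finally show ?thesis using True by (simp add: f_def)
    qed (use r in \<open>simp add: f_def\<close>)
    \<comment> \<open>Convergence at a radius beyond r gives absolute convergence at r.\<close>
    obtain r' where r': "r < r'" "r' < 1" using r dense by blast
    have "summable (\<lambda>k. a k * of_real r' ^ k)"
      using sums[of "of_real r'"] r r' by (auto simp: sums_iff)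
    then have summ: "summable (\<lambda>k. norm (a k) * r ^ k)"
      using powser_insidea[of a "of_real r'" "of_real r"] r r' by (simp add: norm_mult norm_power)
    have fint: "integrable (disc_measure \<alpha>) (f k)" for k
      by (rule integrable_disc_bounded[OF \<alpha> _ bound]) simp_all
    have "(\<integral>z. (\<Sum>k. f k z) \<partial>disc_measure \<alpha>) = (\<Sum>k. integral\<^sup>L (disc_measure \<alpha>) (f k))"
    proof (rule integral_suminf[OF fint])
      show "AE z in disc_measure \<alpha>. summable (\<lambda>k. norm (f k z))"
        by (rule eventually_mono[OF AE_disc_measure])
          (rule summable_comparison_test'[OF summ, of 0], use bound in simp)
      have "(\<integral>z. norm (f k z) \<partial>disc_measure \<alpha>) \<le> (\<integral>z. norm (a k) * r ^ k \<partial>disc_measure \<alpha>)" for k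
      proof (rule integral_mono_AE)
        show "integrable (disc_measure \<alpha>) (\<lambda>z. norm (f k z))" using fint by simp
        show "integrable (disc_measure \<alpha>) (\<lambda>z. norm (a k) * r ^ k)"
          by (rule finite_measure.integrable_const[OF finite_disc_measure[OF \<alpha>]])
        show "AE z in disc_measure \<alpha>. norm (f k z) \<le> norm (a k) * r ^ k"
          by (rule eventually_mono[OF AE_disc_measure]) (rule bound)
      qed
      moreover have "(\<integral>z. 1 \<partial>disc_measure \<alpha>) = (1::real)"
        using integral_disc_measure_power[OF \<alpha>, of 0] by simp
      ultimately have "norm (\<integral>z. norm (f k z) \<partial>disc_measure \<alpha>) \<le> norm (a k) * r ^ k" for k
        by simp
      then show "summable (\<lambda>k. \<integral>z. norm (f k z) \<partial>disc_measure \<alpha>)"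
        by (intro summable_comparison_test'[OF summ])
    qed
    also have "(\<lambda>z. \<Sum>k. f k z) = (\<lambda>z. indicator (ball 0 r) z *\<^sub>R (cnj z ^ n * F z))"
    proof
      fix z
      show "(\<Sum>k. f k z) = indicator (ball 0 r) z *\<^sub>R (cnj z ^ n * F z)"
      proof (cases "norm z < r")
        case True
        then have "(\<lambda>k. cnj z ^ n * (a k * z ^ k)) sums (cnj z ^ n * F z)"
          using r by (intro sums_mult sums) auto
        then show ?thesis using True by (simp add: f_def sums_iff)
      qed (simp add: f_def)
    qed
    also have "(\<Sum>k. integral\<^sup>L (disc_measure \<alpha>) (f k)) = (\<Sum>k. if k = n then a n * J r n else 0)"
    proof (rule suminf_cong)
      fix k
      show "integral\<^sup>L (disc_measure \<alpha>) (f k) = (if k = n then a n * J r n else 0)"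
      proof -
        have "integral\<^sup>L (disc_measure \<alpha>) (f k)
            = (\<integral>z. a k * (indicator (ball 0 r) z *\<^sub>R (cnj z ^ n * z ^ k)) \<partial>disc_measure \<alpha>)"
          unfolding f_def by (intro Bochner_Integration.integral_cong) (auto simp: mult_ac)
        also have "\<dots> = a k * J r k" unfolding J_def by (rule integral_mult_right_zero)
        finally show ?thesis
          using integral_disc_monomials_orthogonal[of n k, where r = r and \<alpha> = \<alpha>] by (auto simp: J_def)
      qed
    qed
    also have "(\<Sum>k. if k = n then a n * J r n else 0) = a n * J r n"
      using sums_single[of n "\<lambda>_. a n * J r n"] by (simp add: sums_iff)
    finally show ?thesis .
  qed
  define r where "r m = 1 - inverse (real (Suc (Suc m)))" for m
  have r: "0 < r m" "r m < 1" for m by (auto simp: r_def field_simps)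
  have int2: "integrable (disc_measure \<alpha>) (\<lambda>z. cnj z ^ n * F z)"
    by (rule Bochner_Integration.integrable_bound[OF int])
      (auto intro!: eventually_mono[OF AE_disc_measure[of \<alpha>]] mult_left_le_one_le power_le_one
        simp: norm_mult norm_power)
  have int3: "integrable (disc_measure \<alpha>) (\<lambda>z. cnj z ^ n * z ^ n)"
    by (rule integrable_disc_bounded[OF \<alpha>, where B = 1])
      (auto simp: norm_mult norm_power power_le_one mult_le_one)
  have "(\<lambda>m. a n * J (r m) n) \<longlonglongrightarrow> (\<integral>z. cnj z ^ n * F z \<partial>disc_measure \<alpha>)"
    using tendsto_integral_subdiscs[OF int2] part[OF r] by (simp add: r_def)
  moreover have "(\<lambda>m. a n * J (r m) n) \<longlonglongrightarrow> a n * (\<integral>z. cnj z ^ n * z ^ n \<partial>disc_measure \<alpha>)"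
    using tendsto_integral_subdiscs[OF int3] unfolding J_def r_def by (intro tendsto_mult_left) simp
  ultimately have "(\<integral>z. cnj z ^ n * F z \<partial>disc_measure \<alpha>) = a n * (\<integral>z. cnj z ^ n * z ^ n \<partial>disc_measure \<alpha>)"
    by (rule LIMSEQ_unique)
  also have "(\<lambda>z. cnj z ^ n * z ^ n) = (\<lambda>z. complex_of_real ((norm z)\<^sup>2 ^ n))"
  proof
    fix z
    have "cnj z ^ n * z ^ n = (complex_of_real ((norm z)\<^sup>2)) ^ n"
      unfolding complex_norm_square by (simp only: power_mult_distrib mult.commute)
    then show "cnj z ^ n * z ^ n = complex_of_real ((norm z)\<^sup>2 ^ n)" by simp
  qed
  also have "(\<integral>z. complex_of_real ((norm z)\<^sup>2 ^ n) \<partial>disc_measure \<alpha>) = of_real (fact n / pochhammer (\<alpha> + 2) n)"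
    using integral_disc_measure_power[OF \<alpha>, of n] by (simp only: integral_complex_of_real)
  finally show ?thesis by (simp add: a_def)
qed

text \<open>Expanding the kernel in powers of \<open>cnj z\<close>, the monomial integrals turn the
  binomial coefficients into the Taylor coefficients of \<open>F\<close>.\<close>

lemma disc_kernel_reproducing:
  assumes \<alpha>: "\<alpha> > -1" and hol: "F holomorphic_on ball 0 1" and int: "integrable (disc_measure \<alpha>) F"
    and w: "norm w < 1"
  shows "(\<integral>z. cnj ((1 - z * cnj w) powr of_real (- (\<alpha> + 2))) * F z \<partial>disc_measure \<alpha>) = F w"
proof -
  define c where "c n = pochhammer (\<alpha> + 2) n / fact n" for n
  have c_pos: "c n > 0" for n using \<alpha> by (simp add: c_def pochhammer_pos)
  have [measurable]: "F \<in> borel_measurable borel"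
    using borel_measurable_integrable[OF int] by (simp add: measurable_def)
  have binom: "(\<lambda>n. of_real (c n) * x ^ n) sums (1 - x) powr of_real (- (\<alpha> + 2))"
    if "norm x < 1" for x :: complex
  proof -
    have "(\<lambda>n. (complex_of_real (- (\<alpha> + 2)) gchoose n) * (- x) ^ n) sums (1 + (- x)) powr of_real (- (\<alpha> + 2))"
      using that by (intro gen_binomial_complex) simp
    moreover have "(complex_of_real (- (\<alpha> + 2)) gchoose n) * (- x) ^ n = of_real (c n) * x ^ n" for n
    proof -
      have "(complex_of_real (- (\<alpha> + 2)) gchoose n) = of_real ((- 1) ^ n * c n)"
        by (simp add: gbinomial_pochhammer c_def add.commute flip: pochhammer_of_real)
      then show ?thesis by (simp flip: power_minus mult.assoc power_mult_distrib) 
    qed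
    ultimately show ?thesis by simp
  qed
  have K: "(\<lambda>n. of_real (c n) * (cnj z * w) ^ n) sums cnj ((1 - z * cnj w) powr of_real (- (\<alpha> + 2)))"
    if "norm z < 1" for z
  proof -
    have "norm z * norm w < 1 * 1" using that w by (intro mult_strict_mono) auto
    then have "(\<lambda>n. of_real (c n) * (z * cnj w) ^ n) sums (1 - z * cnj w) powr of_real (- (\<alpha> + 2))"
      by (intro binom) (simp add: norm_mult)
    then show ?thesis by (subst (asm) sums_cnj[symmetric]) simp
  qed
  define f where "f n z = of_real (c n) * (cnj z * w) ^ n * F z" for n z
  have [measurable]: "f n \<in> borel_measurable borel" for n unfolding f_def by measurable
  \<comment> \<open>In contrast to the Taylor series of F, the expansion of the kernel converges
    uniformly on the whole disc because |w| < 1. It can be integrated termwise against |F| without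
    shrinking the disc.\<close>
  have bound: "norm (f n z) \<le> (c n * norm w ^ n) * norm (F z)" if "norm z < 1" for n z
    using c_pos[of n] that unfolding f_def
    by (auto simp: norm_mult norm_power power_mult_distrib intro!: mult_right_mono mult_left_mono
        mult_left_le_one_le power_le_one)
  have summ: "summable (\<lambda>n. c n * norm w ^ n)"
  proof -
    obtain r where r: "norm w < r" "r < 1" using w dense by blast
    moreover have "0 \<le> r" using r norm_ge_zero[of w] by linarith
    ultimately have "summable (\<lambda>n. complex_of_real (c n) * of_real r ^ n)"
      by (intro sums_summable[OF binom]) simp
    then show ?thesis
      using powser_insidea[of "\<lambda>n. of_real (c n)" "complex_of_real r" w] r c_pos
      by (simp add: norm_mult norm_power less_imp_le)
  qed
  have fint: "integrable (disc_measure \<alpha>) (f n)" for n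
    by (rule Bochner_Integration.integrable_bound[of _ "\<lambda>z. (c n * norm w ^ n) * norm (F z)"])
      (use int c_pos[of n] bound in \<open>auto intro!: eventually_mono[OF AE_disc_measure[of \<alpha>]]\<close>)
  have "(\<integral>z. cnj ((1 - z * cnj w) powr of_real (- (\<alpha> + 2))) * F z \<partial>disc_measure \<alpha>)
      = (\<integral>z. (\<Sum>n. f n z) \<partial>disc_measure \<alpha>)"
  proof (rule integral_cong_AE)
    show "AE z in disc_measure \<alpha>. cnj ((1 - z * cnj w) powr of_real (- (\<alpha> + 2))) * F z = (\<Sum>n. f n z)"
      by (rule eventually_mono[OF AE_disc_measure])
        (use sums_mult2[OF K] in \<open>auto simp: f_def sums_iff\<close>)
  qed measurable
  also have "\<dots> = (\<Sum>n. integral\<^sup>L (disc_measure \<alpha>) (f n))"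
  proof (rule integral_suminf[OF fint])
    show "AE z in disc_measure \<alpha>. summable (\<lambda>n. norm (f n z))"
      by (rule eventually_mono[OF AE_disc_measure])
        (rule summable_comparison_test'[OF summable_mult2[OF summ], of 0], use bound in simp)
    have "(\<integral>z. norm (f n z) \<partial>disc_measure \<alpha>) \<le> (\<integral>z. (c n * norm w ^ n) * norm (F z) \<partial>disc_measure \<alpha>)" for n
      by (rule integral_mono_AE) (use fint int bound in \<open>auto intro!: eventually_mono[OF AE_disc_measure]\<close>)
    then have "norm (\<integral>z. norm (f n z) \<partial>disc_measure \<alpha>) \<le> (c n * norm w ^ n) * (\<integral>z. norm (F z) \<partial>disc_measure \<alpha>)" for n
      by simp
    then show "summable (\<lambda>n. \<integral>z. norm (f n z) \<partial>disc_measure \<alpha>)"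
      by (intro summable_comparison_test'[OF summable_mult2[OF summ]])
  qed
  also have "(\<Sum>n. integral\<^sup>L (disc_measure \<alpha>) (f n)) = (\<Sum>n. (deriv ^^ n) F 0 / fact n * w ^ n)"
  proof (rule suminf_cong)
    fix n
    have "integral\<^sup>L (disc_measure \<alpha>) (f n) = (\<integral>z. (of_real (c n) * w ^ n) * (cnj z ^ n * F z) \<partial>disc_measure \<alpha>)"
      unfolding f_def by (intro Bochner_Integration.integral_cong) (auto simp: power_mult_distrib mult_ac)
    also have "\<dots> = (of_real (c n) * w ^ n) * (\<integral>z. cnj z ^ n * F z \<partial>disc_measure \<alpha>)"
      by simp
    also have "\<dots> = (deriv ^^ n) F 0 / fact n * w ^ n"
      using \<alpha> pochhammer_pos[of "\<alpha> + 2" n]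
      by (simp add: integral_disc_monomial_holomorphic[OF \<alpha> hol int] c_def)
    finally show "integral\<^sup>L (disc_measure \<alpha>) (f n) = (deriv ^^ n) F 0 / fact n * w ^ n" .
  qed
  also have "(\<Sum>n. (deriv ^^ n) F 0 / fact n * w ^ n) = F w"
    using holomorphic_power_series[OF hol, of w] w by (simp add: sums_iff)
  finally show ?thesis .
qed

section \<open>Slice extension and restriction\<close>

definition slice_emb :: "quat \<Rightarrow> complex \<Rightarrow> quat" where
  "slice_emb i z = of_real (Re z) + i * of_real (Im z)"

lemma slice_emb_eq: "slice_emb i z = Re z *\<^sub>R 1 + Im z *\<^sub>R i"
  by (simp add: slice_emb_def of_real_def)

lemma bounded_linear_slice_emb: "bounded_linear (slice_emb i)"
  unfolding slice_emb_eq
  by (intro bounded_linear_intros bounded_linear_Re bounded_linear_Im)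

lemma slice_emb_diff: "slice_emb i (z - w) = slice_emb i z - slice_emb i w"
  and slice_emb_scaleR: "slice_emb i (r *\<^sub>R z) = r *\<^sub>R slice_emb i z"
  and slice_emb_of_real [simp]: "slice_emb i (of_real r) = of_real r"
  and slice_emb_0 [simp]: "slice_emb i 0 = 0"
  and slice_emb_1 [simp]: "slice_emb i 1 = 1"
  and slice_emb_ii [simp]: "slice_emb i \<i> = i"
  by (simp_all add: slice_emb_eq algebra_simps of_real_def)

lemma continuous_slice_emb: "continuous_on A (slice_emb i)"
  using bounded_linear_slice_emb by (rule linear_continuous_on)

lemma measurable_slice_emb [measurable]: "slice_emb i \<in> borel_measurable borel"
  by (intro borel_measurable_continuous_onI continuous_slice_emb)

lemma qcnj_mult: "qcnj (x * y) = qcnj y * qcnj x"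
  by (simp add: quat_eq_iff)

lemma qcnj_add: "qcnj (x + y) = qcnj x + qcnj y"
  by (simp add: quat_eq_iff)

lemma qcnj_scaleR: "qcnj (r *\<^sub>R x) = r *\<^sub>R qcnj x"
  by (simp add: quat_eq_iff)

lemma qcnj_qcnj [simp]: "qcnj (qcnj x) = x"
  by (simp add: quat_eq_iff)

lemma qcnj_of_real [simp]: "qcnj (of_real r) = of_real r"
  by (simp add: quat_eq_iff)

lemma qcnj_mult_self: "qcnj x * x = of_real ((norm x)\<^sup>2)"
  by (simp add: quat_eq_iff power2_norm_eq_inner inner_quat_def)

lemma norm_qcnj [simp]: "norm (qcnj x) = norm x"
  by (simp add: norm_quat_def inner_quat_def)

lemma bounded_linear_qcnj: "bounded_linear qcnj"
  by (rule bounded_linear_intro[where K = 1]) (simp_all add: qcnj_add qcnj_scaleR)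

lemma abs_qre_le_norm: "\<bar>qre x\<bar> \<le> norm x"
  using Cauchy_Schwarz_ineq2[of x 1] by (simp add: inner_quat_def)

lemma bounded_linear_qre: "bounded_linear qre"
  by (rule bounded_linear_intro[where K = 1]) (simp_all add: abs_qre_le_norm)

lemma qImv_eq: "qImv x = x - qre x *\<^sub>R 1"
  by (simp add: qImv_def of_real_def)

lemma bounded_linear_qImv: "bounded_linear qImv"
  unfolding qImv_eq
  by (intro bounded_linear_sub bounded_linear_ident bounded_linear_compose[OF bounded_linear_scaleR_left bounded_linear_qre])

lemma norm_qImv_sq: "(norm x)\<^sup>2 = (qre x)\<^sup>2 + (norm (qImv x))\<^sup>2"
  unfolding power2_norm_eq_inner inner_quat_def qImv_def by (simp add: power2_eq_square)

lemma qImv_diff_of_real [simp]: "qImv (x - of_real a) = qImv x"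
  by (simp add: qImv_def)

definition slice_coord :: "quat \<Rightarrow> complex" where
  "slice_coord x = Complex (qre x) (norm (qImv x))"

lemma norm_slice_coord [simp]: "norm (slice_coord x) = norm x"
  by (simp add: slice_coord_def cmod_def norm_qImv_sq[of x, symmetric])

text \<open>Together with \<open>slice_odd\<close> this solves h(z) = u + i v and h(cnj z) = u - i v
  for the two components u and v; the factor - i in \<open>slice_odd\<close> is the inverse of
  i.\<close>

definition slice_even :: "(complex \<Rightarrow> quat) \<Rightarrow> complex \<Rightarrow> quat" where
  "slice_even h z = (h z + h (cnj z)) /\<^sub>R 2"

definition slice_odd :: "quat \<Rightarrow> (complex \<Rightarrow> quat) \<Rightarrow> complex \<Rightarrow> quat" where
  "slice_odd i h z = (- i) * (h z - h (cnj z)) /\<^sub>R 2"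

text \<open>At real points, where the imaginary unit is arbitrary, \<open>i\<close> is used.\<close>

definition qunit :: "quat \<Rightarrow> quat \<Rightarrow> quat" where
  "qunit i x = (if qImv x = 0 then i else qImv x /\<^sub>R norm (qImv x))"

text \<open>The representation formula for slice hyperholomorphic functions, with h given on the
  complex disc. At real points \<open>slice_odd\<close> vanishes, so the choice made in
  \<open>qunit\<close> does not affect the value; 0 off the ball is the convention of
  \<open>slice_hyp_functions\<close>.\<close>

definition qext :: "quat \<Rightarrow> (complex \<Rightarrow> quat) \<Rightarrow> quat \<Rightarrow> quat" where
  "qext i h x = (if x \<in> qDisc
     then slice_even h (slice_coord x) + qunit i x * slice_odd i h (slice_coord x) else 0)"

text \<open>The Cauchy-Riemann equations packed into one derivative: it is linear for the left
  action of the slice, so the constant quaternion d stands on the right.\<close>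

definition left_holomorphic :: "quat \<Rightarrow> (complex \<Rightarrow> quat) \<Rightarrow> bool" where
  "left_holomorphic i h \<longleftrightarrow>
    (\<forall>z. norm z < 1 \<longrightarrow> (\<exists>d. (h has_derivative (\<lambda>\<zeta>. slice_emb i \<zeta> * d)) (at z)))"

lemma qext_add: "qext i (\<lambda>z. h z + k z) x = qext i h x + qext i k x"
  by (simp add: qext_def slice_even_def slice_odd_def scaleR_add_right algebra_simps)

lemma qext_mult_right: "qext i (\<lambda>z. h z * q) x = qext i h x * q"
  by (simp add: qext_def slice_even_def slice_odd_def algebra_simps)

lemma qext_cong: "(\<And>z. norm z < 1 \<Longrightarrow> h z = k z) \<Longrightarrow> qext i h = qext i k"
  by (auto simp: fun_eq_iff qext_def slice_even_def slice_odd_def qDisc_def)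

lemma left_holomorphic_add:
  assumes "left_holomorphic i h" "left_holomorphic i k"
  shows "left_holomorphic i (\<lambda>z. h z + k z)"
  unfolding left_holomorphic_def
proof safe
  fix z :: complex assume "norm z < 1"
  then obtain d e where "(h has_derivative (\<lambda>\<zeta>. slice_emb i \<zeta> * d)) (at z)"
    "(k has_derivative (\<lambda>\<zeta>. slice_emb i \<zeta> * e)) (at z)"
    using assms unfolding left_holomorphic_def by blast
  from has_derivative_add[OF this]
  show "\<exists>d. ((\<lambda>z. h z + k z) has_derivative (\<lambda>\<zeta>. slice_emb i \<zeta> * d)) (at z)"
    by (intro exI[of _ "d + e"]) (simp add: distrib_left)
qed

lemma left_holomorphic_mult_right:
  assumes "left_holomorphic i h"
  shows "left_holomorphic i (\<lambda>z. h z * q)"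
  unfolding left_holomorphic_def
proof safe
  fix z :: complex assume "norm z < 1"
  then obtain d where "(h has_derivative (\<lambda>\<zeta>. slice_emb i \<zeta> * d)) (at z)"
    using assms unfolding left_holomorphic_def by blast
  from has_derivative_mult_left[OF this, of q]
  show "\<exists>d. ((\<lambda>z. h z * q) has_derivative (\<lambda>\<zeta>. slice_emb i \<zeta> * d)) (at z)"
    by (intro exI[of _ "d * q"]) (simp add: mult.assoc)
qed

locale slice_unit =
  fixes i :: quat
  assumes unit: "i \<in> qSphere"
begin

lemma qre_i [simp]: "qre i = 0" and norm_i [simp]: "norm i = 1"
  using unit by (auto simp: qSphere_def)

lemma inner_i_1 [simp]: "inner i 1 = 0" "inner 1 i = 0"
  by (simp_all add: inner_quat_def)

lemma sphere_sq: "I \<in> qSphere \<Longrightarrow> I * I = - 1"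
proof -
  assume I: "I \<in> qSphere"
  then have "inner I I = 1" "qre I = 0" by (auto simp: qSphere_def norm_eq_1)
  then show ?thesis by (simp add: quat_eq_iff inner_quat_def mult.commute)
qed

lemma i_sq [simp]: "i * i = - 1"
  by (rule sphere_sq[OF unit])

lemma i_i_mult [simp]: "i * (i * x) = - x"
  by (simp flip: mult.assoc)

lemma qcnj_i [simp]: "qcnj i = - i"
  by (simp add: quat_eq_iff)

lemma slice_emb_mult: "slice_emb i (z * w) = slice_emb i z * slice_emb i w"
  by (simp add: slice_emb_eq algebra_simps)

lemma slice_emb_cnj: "slice_emb i (cnj z) = qcnj (slice_emb i z)"
  by (simp add: slice_emb_eq qcnj_add qcnj_scaleR quat_eq_iff)

lemma norm_slice_emb [simp]: "norm (slice_emb i z) = norm z"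
proof -
  have "inner (slice_emb i z) (slice_emb i z) = (norm z)\<^sup>2"
    unfolding slice_emb_eq inner_add_left inner_add_right inner_scaleR_left inner_scaleR_right
    by (simp add: dot_square_norm cmod_power2) (simp add: power2_eq_square)
  then show ?thesis by (simp add: norm_eq_sqrt_inner)
qed

lemma slice_emb_inj: "slice_emb i z = slice_emb i w \<Longrightarrow> z = w"
  using norm_slice_emb[of "z - w"] by (simp add: slice_emb_diff)

lemma slice_emb_commute: "slice_emb i z * slice_emb i w = slice_emb i w * slice_emb i z"
  by (simp add: mult.commute flip: slice_emb_mult)

lemma qre_slice_emb [simp]: "qre (slice_emb i z) = Re z"
  by (simp add: slice_emb_def)

lemma qImv_slice_emb: "qImv (slice_emb i z) = Im z *\<^sub>R i"
  by (simp add: qImv_eq) (simp add: slice_emb_eq)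

lemma slice_disc_eq: "slice_disc i = slice_emb i ` ball 0 1"
proof -
  have "qslice i = range (slice_emb i)"
    unfolding qslice_def slice_emb_def
    by (auto intro: range_eqI[of _ _ "Complex _ _"])
  then show ?thesis
    unfolding slice_disc_def by (auto simp: qDisc_def)
qed

lemma qunit_sphere: "qunit i x \<in> qSphere"
  using unit by (auto simp: qunit_def qSphere_def qImv_def)

lemma qunit_repr: "x = of_real (qre x) + qunit i x * of_real (norm (qImv x))"
  by (auto simp: qunit_def of_real_def) (auto simp: qImv_eq)

lemma norm_qunit [simp]: "norm (qunit i x) = 1"
  using qunit_sphere by (auto simp: qSphere_def)

text \<open>\<open>slice_coord\<close> always lands in the closed upper half plane. For a point
  below the real axis it returns the conjugate, while \<open>qunit\<close> turns into - i, and the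
  two sign changes cancel.\<close>

lemma qext_slice_emb:
  assumes "norm z < 1"
  shows "qext i h (slice_emb i z) = h z"
proof -
  have D: "slice_emb i z \<in> qDisc" using assms by (simp add: qDisc_def)
  have c: "slice_coord (slice_emb i z) = Complex (Re z) \<bar>Im z\<bar>"
    by (simp add: slice_coord_def qImv_slice_emb)
  have half: "(a + b) /\<^sub>R 2 + (a - b) /\<^sub>R 2 = a" "(a + b) /\<^sub>R 2 - (b - a) /\<^sub>R 2 = a" for a b :: quat
    by (simp_all add: quat_eq_iff field_simps)
  consider "Im z = 0" | "Im z > 0" | "Im z < 0" by linarith
  then show ?thesis
  proof cases
    case 1
    then have "cnj z = z" "Complex (Re z) \<bar>Im z\<bar> = z" by (simp_all add: complex_eq_iff)
    then show ?thesis using D by (simp add: qext_def c slice_even_def slice_odd_def)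
  next
    case 2
    then have "Complex (Re z) \<bar>Im z\<bar> = z" by (simp add: complex_eq_iff)
    moreover have "qunit i (slice_emb i z) = i"
      using 2 by (auto simp: qunit_def qImv_slice_emb)
    ultimately show ?thesis using D half[of "h z" "h (cnj z)"]
      by (simp add: qext_def c slice_even_def slice_odd_def)
  next
    case 3
    then have "Complex (Re z) \<bar>Im z\<bar> = cnj z" by (simp add: complex_eq_iff)
    moreover have "qunit i (slice_emb i z) = - i"
      using 3 by (auto simp: qunit_def qImv_slice_emb)
    ultimately show ?thesis using D half[of "h z" "h (cnj z)"]
      by (simp add: qext_def c slice_even_def slice_odd_def algebra_simps)
  qed
qed


lemma left_holomorphic_mult_left:
  assumes "left_holomorphic i h"
  shows "left_holomorphic i (\<lambda>z. i * h z)"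
  unfolding left_holomorphic_def
proof safe
  fix z :: complex assume "norm z < 1"
  then obtain d where "(h has_derivative (\<lambda>\<zeta>. slice_emb i \<zeta> * d)) (at z)"
    using assms unfolding left_holomorphic_def by blast
  from has_derivative_mult_right[OF this, of i]
  show "\<exists>d. ((\<lambda>z. i * h z) has_derivative (\<lambda>\<zeta>. slice_emb i \<zeta> * d)) (at z)"
    using slice_emb_commute[of _ \<i>]
    by (intro exI[of _ "i * d"]) (simp flip: mult.assoc)
qed

lemma left_holomorphic_slice_emb:
  assumes "F holomorphic_on ball 0 1"
  shows "left_holomorphic i (\<lambda>z. slice_emb i (F z))"
  unfolding left_holomorphic_def
proof safe
  fix z :: complex assume z: "norm z < 1"
  then have "(F has_field_derivative deriv F z) (at z)"
    using assms by (intro holomorphic_derivI[of _ "ball 0 1"]) auto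
  then have "(F has_derivative (\<lambda>\<zeta>. \<zeta> * deriv F z)) (at z)"
    by (simp add: has_field_derivative_def mult_commute_abs)
  from bounded_linear.has_derivative[OF bounded_linear_slice_emb[of i] this]
  show "\<exists>d. ((\<lambda>z. slice_emb i (F z)) has_derivative (\<lambda>\<zeta>. slice_emb i \<zeta> * d)) (at z)"
    by (auto simp: slice_emb_mult)
qed

lemma left_holomorphic_partials:
  assumes "(h has_derivative (\<lambda>\<zeta>. slice_emb i \<zeta> * d)) (at (Complex a b))"
  shows "((\<lambda>t. h (Complex t b)) has_vector_derivative d) (at a)"
    "((\<lambda>t. h (Complex a t)) has_vector_derivative i * d) (at b)"
proof -
  have "((\<lambda>t. of_real t + \<i> * of_real b) has_vector_derivative 1) (at a)"
    by (auto intro!: derivative_eq_intros)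
  then have "((\<lambda>t. Complex t b) has_vector_derivative 1) (at a)"
    by (simp add: Complex_eq[abs_def])
  from vector_derivative_diff_chain_within[OF this has_derivative_at_withinI[OF assms]]
  show "((\<lambda>t. h (Complex t b)) has_vector_derivative d) (at a)" by (simp add: o_def)
  have "((\<lambda>t. of_real a + \<i> * of_real t) has_vector_derivative \<i>) (at b)"
    by (auto intro!: derivative_eq_intros)
  then have "((\<lambda>t. Complex a t) has_vector_derivative \<i>) (at b)"
    by (simp add: Complex_eq[abs_def])
  from vector_derivative_diff_chain_within[OF this has_derivative_at_withinI[OF assms]]
  show "((\<lambda>t. h (Complex a t)) has_vector_derivative i * d) (at b)" by (simp add: o_def)
qed

lemma has_derivative_cnj_comp:
  assumes "(h has_derivative (\<lambda>\<zeta>. slice_emb i \<zeta> * d)) (at (cnj z))"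
  shows "((\<lambda>z. h (cnj z)) has_derivative (\<lambda>\<zeta>. slice_emb i (cnj \<zeta>) * d)) (at z)"
  using has_derivative_compose[OF bounded_linear_imp_has_derivative[OF bounded_linear_cnj] assms] .

text \<open>Away from the real axis the unit \<open>I\<^sub>x\<close> depends smoothly on \<open>x\<close>. At a real point the first
  order expansion of \<open>h\<close> on the slice transfers with the same derivative, because the
  remainder is estimated by its values at the two conjugate points of the slice.\<close>

lemma qext_differentiable:
  assumes h: "left_holomorphic i h"
  shows "qext i h differentiable_on qDisc"
proof -
  have "qext i h differentiable (at x)" if x: "x \<in> qDisc" for x
  proof (cases "qImv x = 0")
    case False
    define z where "z = slice_coord x"
    have z: "norm z < 1" using x by (simp add: z_def qDisc_def)
    then obtain d where d: "(h has_derivative (\<lambda>\<zeta>. slice_emb i \<zeta> * d)) (at z)"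
      using h unfolding left_holomorphic_def by blast
    obtain e where "(h has_derivative (\<lambda>\<zeta>. slice_emb i \<zeta> * e)) (at (cnj z))"
      using h z unfolding left_holomorphic_def by force
    from has_derivative_cnj_comp[OF this] have e: "(\<lambda>z. h (cnj z)) differentiable at z"
      unfolding differentiable_def by blast
    from d have "h differentiable at z" unfolding differentiable_def by blast
    with e have ev: "slice_even h differentiable at z" "slice_odd i h differentiable at z"
      unfolding slice_even_def[abs_def] slice_odd_def[abs_def]
      by (auto intro!: derivative_intros differentiable_mult differentiable_scaleR differentiable_const)
    have n: "(\<lambda>x. norm (qImv x)) differentiable at x"
      using differentiable_chain_at[of qImv x norm] False by (auto simp: o_def differentiable_norm_at
         intro: bounded_linear_imp_differentiable[OF bounded_linear_qImv])
    have eq: "slice_coord = (\<lambda>x. qre x *\<^sub>R 1 + norm (qImv x) *\<^sub>R \<i>)"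
      by (simp add: slice_coord_def fun_eq_iff complex_eq_iff)
    have c: "slice_coord differentiable at x"
      unfolding eq using n by (intro differentiable_add differentiable_scaleR differentiable_const
         bounded_linear_imp_differentiable[OF bounded_linear_qre])
    have u: "(\<lambda>x. inverse (norm (qImv x)) *\<^sub>R qImv x) differentiable at x"
      using n False by (intro differentiable_scaleR differentiable_inverse
         bounded_linear_imp_differentiable[OF bounded_linear_qImv]) auto
    have D: "(\<lambda>x. slice_even h (slice_coord x) + (inverse (norm (qImv x)) *\<^sub>R qImv x) * slice_odd i h (slice_coord x)) differentiable at x"
      using differentiable_chain_at[OF c, of "slice_even h"] differentiable_chain_at[OF c, of "slice_odd i h"] ev u
      by (intro differentiable_add differentiable_mult) (auto simp: o_def z_def)
    have op: "open (qDisc \<inter> {x. qImv x \<noteq> 0})"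
      unfolding qDisc_def using linear_continuous_on[OF bounded_linear_qImv]
      by (intro open_Int open_ball open_Collect_neq continuous_on_const)
    from D obtain D' where "((\<lambda>x. slice_even h (slice_coord x) + (inverse (norm (qImv x)) *\<^sub>R qImv x) * slice_odd i h (slice_coord x)) has_derivative D') (at x)"
      unfolding differentiable_def by blast
    then have "(qext i h has_derivative D') (at x)"
      by (rule has_derivative_transform_within_open[OF _ op]) (use x False in \<open>auto simp: qext_def qunit_def\<close>)
    then show ?thesis unfolding differentiable_def by blast
  next
    case True
    define a where "a = qre x"
    have xa: "x = of_real a" using True by (simp add: qImv_def a_def)
    have a: "\<bar>a\<bar> < 1" using x by (simp add: xa qDisc_def)
    obtain d where d: "(h has_derivative (\<lambda>\<zeta>. slice_emb i \<zeta> * d)) (at (of_real a))"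
      using h a unfolding left_holomorphic_def by force
    have gx: "qext i h x = h (of_real a)"
      using qext_slice_emb[of "of_real a" h] a by (simp add: xa)
    have "(qext i h has_derivative (\<lambda>H. H * d)) (at x)"
      unfolding has_derivative_at_alt
    proof (intro conjI allI impI)
      show "bounded_linear (\<lambda>H. H * d)" by (rule bounded_linear_mult_left)
      fix e :: real assume "e > 0"
      \<comment> \<open>Half of e, because the remainders at both conjugate points enter the even
        part and again the odd part.\<close>
      then have "e / 2 > 0" by simp
      with d obtain \<delta> where \<delta>: "\<delta> > 0" and est:
        "\<And>w. norm (w - of_real a) < \<delta> \<Longrightarrow> norm (h w - h (of_real a) - slice_emb i (w - of_real a) * d) \<le> e / 2 * norm (w - of_real a)"
        unfolding has_derivative_at_alt by meson
      show "\<exists>\<delta>>0. \<forall>y. norm (y - x) < \<delta> \<longrightarrow>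
          norm (qext i h y - qext i h x - (y - x) * d) \<le> e * norm (y - x)"
      proof (intro exI[of _ "min \<delta> (1 - \<bar>a\<bar>)"] conjI allI impI)
        show "0 < min \<delta> (1 - \<bar>a\<bar>)" using \<delta> a by simp
        fix y assume y: "norm (y - x) < min \<delta> (1 - \<bar>a\<bar>)"
        have "norm y \<le> norm (y - x) + norm x" by norm
        with y have yD: "y \<in> qDisc" by (simp add: xa qDisc_def)
        define \<zeta> where "\<zeta> = slice_coord (y - x)"
        have \<zeta>: "norm \<zeta> = norm (y - x)" by (simp add: \<zeta>_def)
        have yc: "slice_coord y = of_real a + \<zeta>"
          by (simp add: \<zeta>_def slice_coord_def xa complex_eq_iff)
        define I where "I = qunit i y"
        have I: "norm I = 1" by (simp add: I_def)
        define R S where "R = h (of_real a + \<zeta>) - h (of_real a) - slice_emb i \<zeta> * d"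
          and "S = h (of_real a + cnj \<zeta>) - h (of_real a) - slice_emb i (cnj \<zeta>) * d"
        have RS: "norm R \<le> e / 2 * norm (y - x)" "norm S \<le> e / 2 * norm (y - x)"
          using est[of "of_real a + \<zeta>"] est[of "of_real a + cnj \<zeta>"] y by (simp_all add: R_def S_def \<zeta>)
        have dz: "y - x = of_real (Re \<zeta>) + I * of_real (Im \<zeta>)"
          using qunit_repr[of y] by (simp add: \<zeta>_def slice_coord_def xa I_def algebra_simps)
        have sum: "slice_emb i \<zeta> + slice_emb i (cnj \<zeta>) = 2 *\<^sub>R of_real (Re \<zeta>)"
          and dif: "slice_emb i \<zeta> - slice_emb i (cnj \<zeta>) = 2 *\<^sub>R (Im \<zeta> *\<^sub>R i)"
          by (simp_all add: slice_emb_eq of_real_def quat_eq_iff)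
        have 1: "slice_even h (slice_coord y) = h (of_real a) + of_real (Re \<zeta>) * d + (R + S) /\<^sub>R 2"
        proof -
          have "h (of_real a + \<zeta>) + h (of_real a + cnj \<zeta>)
            = 2 *\<^sub>R h (of_real a) + (slice_emb i \<zeta> + slice_emb i (cnj \<zeta>)) * d + (R + S)"
            by (simp add: R_def S_def algebra_simps scaleR_2)
          then show ?thesis
            unfolding slice_even_def yc sum by (simp add: scaleR_add_right)
        qed
        have 2: "slice_odd i h (slice_coord y) = of_real (Im \<zeta>) * d + (- i) * (R - S) /\<^sub>R 2"
        proof -
          have "h (of_real a + \<zeta>) - h (of_real a + cnj \<zeta>)
            = (slice_emb i \<zeta> - slice_emb i (cnj \<zeta>)) * d + (R - S)"
            by (simp add: R_def S_def algebra_simps)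
          then show ?thesis
            unfolding slice_odd_def yc dif complex_cnj_add complex_cnj_complex_of_real
            by (simp add: scaleR_add_right scaleR_diff_right distrib_left right_diff_distrib of_real_def)
        qed
        have "qext i h y - qext i h x - (y - x) * d = (R + S) /\<^sub>R 2 + I * ((- i) * (R - S) /\<^sub>R 2)"
          unfolding gx using yD by (simp add: qext_def 1 2 dz I_def[symmetric] algebra_simps)
        also have "norm \<dots> \<le> norm ((R + S) /\<^sub>R 2) + norm (I * ((- i) * (R - S) /\<^sub>R 2))"
          by (rule norm_triangle_ineq)
        also have "\<dots> = norm (R + S) / 2 + norm (R - S) / 2"
          by (simp add: norm_mult I)
        also have "\<dots> \<le> (norm R + norm S) / 2 + (norm R + norm S) / 2"
          by (intro add_mono divide_right_mono norm_triangle_ineq norm_triangle_ineq4) simp_all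
        also have "\<dots> \<le> e * norm (y - x)" using RS by simp
        finally show "norm (qext i h y - qext i h x - (y - x) * d) \<le> e * norm (y - x)" .
      qed
    qed
    then show ?thesis unfolding differentiable_def by blast
  qed
  then show ?thesis by (simp add: differentiable_on_def differentiable_at_withinI)
qed


section \<open>Extension and restriction are inverse to each other\<close>

lemma norm_Complex_less_1: "norm (Complex a b) < 1 \<longleftrightarrow> a\<^sup>2 + b\<^sup>2 < 1"
  by (simp add: cmod_def)

lemma qext_in_slice_hyp_functions:
  assumes h: "left_holomorphic i h"
  shows "qext i h \<in> slice_hyp_functions"
proof -
  define u where "u a b = slice_even h (Complex a b)" for a b
  define v where "v a b = slice_odd i h (Complex a b)" for a b
  have cnj_C: "cnj (Complex a b) = Complex a (- b)" for a b by (simp add: complex_eq_iff)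
  \<comment> \<open>Off the real axis x determines the unit I. At a real point I is arbitrary, but v
    vanishes there because it is odd in its second argument.\<close>
  have repr: "qext i h x = u (qre x) (norm (qImv x)) + I * v (qre x) (norm (qImv x))"
    if x: "x \<in> qDisc" "I \<in> qSphere" "x = of_real (qre x) + I * of_real (norm (qImv x))" for x I
  proof (cases "qImv x = 0")
    case True
    then show ?thesis using x(1)
      by (simp add: qext_def u_def v_def slice_coord_def slice_odd_def cnj_C)
  next
    case False
    have "qImv x = norm (qImv x) *\<^sub>R I"
      using x(3) by (simp add: qImv_def of_real_def algebra_simps)
    with False have "qunit i x = I" by (metis (no_types) qunit_def divideR_right inverse_eq_divide norm_eq_zero scaleR_scaleR left_inverse scaleR_one)
    then show ?thesis using x(1) by (simp add: qext_def u_def v_def slice_coord_def)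
  qed
  have CR: "u a b = u a (- b) \<and> v a b = - v a (- b) \<and>
         (\<exists>p q. ((\<lambda>t. u t b) has_vector_derivative p) (at a) \<and>
                ((\<lambda>t. v a t) has_vector_derivative p) (at b) \<and>
                ((\<lambda>t. v t b) has_vector_derivative q) (at a) \<and>
                ((\<lambda>t. u a t) has_vector_derivative (- q)) (at b))" if ab: "a\<^sup>2 + b\<^sup>2 < 1" for a b
  proof -
    obtain d where d: "(h has_derivative (\<lambda>\<zeta>. slice_emb i \<zeta> * d)) (at (Complex a b))"
      using h ab unfolding left_holomorphic_def by (metis norm_Complex_less_1)
    obtain e where e: "(h has_derivative (\<lambda>\<zeta>. slice_emb i \<zeta> * e)) (at (Complex a (- b)))"
      using h ab unfolding left_holomorphic_def by (metis norm_Complex_less_1 power2_minus)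
    note D = left_holomorphic_partials[OF d] and E = left_holomorphic_partials[OF e]
    have "((\<lambda>t. - t) has_vector_derivative - 1) (at b)"
      by (auto intro!: derivative_eq_intros)
    from vector_derivative_diff_chain_within[OF this, of "\<lambda>t. h (Complex a t)" "\<lambda>t. t *\<^sub>R (i * e)"]
    have E2: "((\<lambda>t. h (Complex a (- t))) has_vector_derivative - (i * e)) (at b)"
      using has_derivative_at_withinI[OF E(2)[unfolded has_vector_derivative_def]] by (simp add: o_def)
    \<comment> \<open>The derivative of h is d at the point and e at its conjugate, where the inner
      map t to - t flips the sign of the second partial. The even and odd parts of h then have p and
      q as their derivatives in a.\<close>
    define p where "p = (d + e) /\<^sub>R 2"
    define q where "q = (- i) * (d - e) /\<^sub>R 2"
    have "((\<lambda>t. u t b) has_vector_derivative p) (at a)"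
      unfolding u_def slice_even_def cnj_C p_def
      by (intro bounded_linear.has_vector_derivative[OF bounded_linear_scaleR_right] has_vector_derivative_add D E)
    moreover have "((\<lambda>t. u a t) has_vector_derivative (i * d + - (i * e)) /\<^sub>R 2) (at b)"
      unfolding u_def slice_even_def cnj_C
      by (intro bounded_linear.has_vector_derivative[OF bounded_linear_scaleR_right] has_vector_derivative_add D E2)
    moreover have "((\<lambda>t. v t b) has_vector_derivative q) (at a)"
      unfolding v_def slice_odd_def cnj_C q_def
      by (intro bounded_linear.has_vector_derivative[OF bounded_linear_scaleR_right] has_vector_derivative_mult_right has_vector_derivative_diff D E)
    moreover have "((\<lambda>t. v a t) has_vector_derivative (- i) * (i * d - - (i * e)) /\<^sub>R 2) (at b)"
      unfolding v_def slice_odd_def cnj_C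
      by (intro bounded_linear.has_vector_derivative[OF bounded_linear_scaleR_right] has_vector_derivative_mult_right has_vector_derivative_diff D E2)
    moreover have "(- i) * (i * d - - (i * e)) /\<^sub>R 2 = p" "(i * d + - (i * e)) /\<^sub>R 2 = - q"
      by (simp_all add: p_def q_def algebra_simps)
    ultimately have "\<exists>p q. ((\<lambda>t. u t b) has_vector_derivative p) (at a) \<and>
                ((\<lambda>t. v a t) has_vector_derivative p) (at b) \<and>
                ((\<lambda>t. v t b) has_vector_derivative q) (at a) \<and>
                ((\<lambda>t. u a t) has_vector_derivative (- q)) (at b)"
      by (intro exI[of _ p] exI[of _ q]) simp
    then show ?thesis
      by (simp add: u_def v_def slice_even_def slice_odd_def cnj_C algebra_simps)
  qed
  have "slice_hyperholomorphic (qext i h)"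
    unfolding slice_hyperholomorphic_def
    using qext_differentiable[OF h] repr CR by blast
  then show ?thesis by (simp add: slice_hyp_functions_def qext_def)
qed

text \<open>Converse to \<open>qext_in_slice_hyp_functions\<close>: membership in
  \<open>slice_hyp_functions\<close> can be tested on the slice, and all later constructions are
  carried out there.\<close>

lemma slice_hyp_functions_restrict:
  assumes f: "f \<in> slice_hyp_functions"
  shows "left_holomorphic i (\<lambda>z. f (slice_emb i z))" and "qext i (\<lambda>z. f (slice_emb i z)) = f"
proof -
  from f have F: "slice_hyperholomorphic f" and zero: "\<And>x. x \<notin> qDisc \<Longrightarrow> f x = 0"
    by (simp_all only: slice_hyp_functions_def mem_Collect_eq simp_thms)
  have diff: "f differentiable_on qDisc"
    using F unfolding slice_hyperholomorphic_def by (rule conjunct1)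
  obtain u v where R: "\<forall>x\<in>qDisc. \<forall>I\<in>qSphere. x = of_real (qre x) + I * of_real (norm (qImv x)) \<longrightarrow>
         f x = u (qre x) (norm (qImv x)) + I * v (qre x) (norm (qImv x))"
    and C: "\<forall>a b::real. a\<^sup>2 + b\<^sup>2 < 1 \<longrightarrow> u a b = u a (- b) \<and> v a b = - v a (- b) \<and>
         (\<exists>p q. ((\<lambda>t. u t b) has_vector_derivative p) (at a) \<and>
                ((\<lambda>t. v a t) has_vector_derivative p) (at b) \<and>
                ((\<lambda>t. v t b) has_vector_derivative q) (at a) \<and>
                ((\<lambda>t. u a t) has_vector_derivative (- q)) (at b))"
    using F unfolding slice_hyperholomorphic_def by (elim conjE exE) (rule that)
  note repr = R[rule_format]
  have sym: "u a b = u a (- b)" "v a b = - v a (- b)" if "a\<^sup>2 + b\<^sup>2 < 1" for a b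
    using C[rule_format, OF that] by (simp_all only: simp_thms)
  have CR: "\<exists>p q. ((\<lambda>t. u t b) has_vector_derivative p) (at a) \<and>
                ((\<lambda>t. v a t) has_vector_derivative p) (at b) \<and>
                ((\<lambda>t. v t b) has_vector_derivative q) (at a) \<and>
                ((\<lambda>t. u a t) has_vector_derivative (- q)) (at b)" if "a\<^sup>2 + b\<^sup>2 < 1" for a b
    using C[rule_format, OF that] by (elim conjE)
  define h where "h z = f (slice_emb i z)" for z
  have h_pos: "h (Complex a b) = u a b + i * v a b" "h (Complex a (- b)) = u a b - i * v a b"
    if "0 \<le> b" "a\<^sup>2 + b\<^sup>2 < 1" for a b
  proof -
    have D: "slice_emb i (Complex a b) \<in> qDisc" "slice_emb i (Complex a (- b)) \<in> qDisc"
      using that by (simp_all add: qDisc_def norm_Complex_less_1)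
    have N: "norm (qImv (slice_emb i (Complex a b))) = b" "norm (qImv (slice_emb i (Complex a (- b)))) = b"
      using that by (simp_all add: qImv_slice_emb)
    have E: "slice_emb i (Complex a b) = of_real a + i * of_real b"
      "slice_emb i (Complex a (- b)) = of_real a + (- i) * of_real b"
      by (simp_all add: slice_emb_def)
    \<comment> \<open>The conjugate point has the same two coordinates with unit - i, which changes
      only the sign of the v term.\<close>
    have "- i \<in> qSphere" using unit by (simp add: qSphere_def)
    from repr[OF D(1) unit] repr[OF D(2) this]
    show "h (Complex a b) = u a b + i * v a b" "h (Complex a (- b)) = u a b - i * v a b"
      unfolding h_def N qre_slice_emb complex.sel E[symmetric] by simp_all
  qed
  have h_eq: "h (Complex a b) = u a b + i * v a b" if "a\<^sup>2 + b\<^sup>2 < 1" for a b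
  proof (cases "0 \<le> b")
    case False
    then show ?thesis using h_pos(2)[of "- b" a] sym[OF that] that by simp
  qed (use h_pos that in auto)
  show "qext i (\<lambda>z. f (slice_emb i z)) = f"
  proof
    fix x
    show "qext i (\<lambda>z. f (slice_emb i z)) x = f x"
    proof (cases "x \<in> qDisc")
      case True
      define a b where "a = qre x" and "b = norm (qImv x)"
      have ab: "0 \<le> b" "a\<^sup>2 + b\<^sup>2 < 1"
        using True norm_slice_coord[of x] norm_Complex_less_1[of a b]
        by (simp_all add: a_def b_def slice_coord_def qDisc_def)
      have half: "(u + w + (u - w)) /\<^sub>R 2 = u" "(u + w - (u - w)) /\<^sub>R 2 = w" for u w :: quat
        by (simp_all add: quat_eq_iff)
      have "cnj (Complex a b) = Complex a (- b)" by (simp add: complex_eq_iff)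
      then have "slice_even h (Complex a b) = u a b"
        and "slice_odd i h (Complex a b) = (- i) * (i * v a b)"
        unfolding slice_even_def slice_odd_def using half[of "u a b" "i * v a b"]
        by (simp_all only: h_pos[OF ab] mult_scaleR_right[symmetric])
      then have "qext i h x = u a b + qunit i x * v a b"
        using True by (simp add: qext_def slice_coord_def flip: a_def b_def)
      also have "\<dots> = f x"
        using repr[OF True qunit_sphere qunit_repr] by (simp add: a_def b_def)
      finally show ?thesis by (simp add: h_def[abs_def])
    qed (simp add: zero qext_def)
  qed
  show "left_holomorphic i (\<lambda>z. f (slice_emb i z))"
    unfolding left_holomorphic_def
  proof safe
    fix z :: complex assume z: "norm z < 1"
    define a b where "a = Re z" and "b = Im z"
    have zab: "z = Complex a b" and ab: "a\<^sup>2 + b\<^sup>2 < 1"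
      using z norm_Complex_less_1[of a b] by (simp_all add: a_def b_def)
    have "f differentiable (at (slice_emb i z))"
      using diff z differentiable_on_eq_differentiable_at[of qDisc f] by (simp add: qDisc_def)
    \<comment> \<open>Restricting the total derivative of f to the slice gives a derivative L of h
      that is so far only real linear. The Cauchy-Riemann equations for u and v yield L \<i> = i L
      1, which makes L linear over the slice.\<close>
    then obtain D where D: "(f has_derivative D) (at (slice_emb i z))"
      unfolding differentiable_def by blast
    define L where "L \<zeta> = D (slice_emb i \<zeta>)" for \<zeta>
    have L: "(h has_derivative L) (at z)"
      using has_derivative_compose[OF bounded_linear_imp_has_derivative[OF bounded_linear_slice_emb] D]
      unfolding h_def[abs_def] L_def[abs_def] .
    obtain p q where pq: "((\<lambda>t. u t b) has_vector_derivative p) (at a)"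
                "((\<lambda>t. v a t) has_vector_derivative p) (at b)"
                "((\<lambda>t. v t b) has_vector_derivative q) (at a)"
                "((\<lambda>t. u a t) has_vector_derivative (- q)) (at b)"
      using CR[OF ab] by blast
    have op1: "open {t. t\<^sup>2 + b\<^sup>2 < 1}" and op2: "open {t. a\<^sup>2 + t\<^sup>2 < 1}"
      by (intro open_Collect_less continuous_intros)+
    have "((\<lambda>t. u t b + i * v t b) has_vector_derivative p + i * q) (at a)"
      by (intro has_vector_derivative_add has_vector_derivative_mult_right pq)
    then have 1: "((\<lambda>t. h (Complex t b)) has_vector_derivative p + i * q) (at a)"
      by (rule has_vector_derivative_transform_within_open[OF _ op1]) (use ab h_eq in auto)
    have "((\<lambda>t. u a t + i * v a t) has_vector_derivative - q + i * p) (at b)"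
      by (intro has_vector_derivative_add has_vector_derivative_mult_right pq)
    then have 2: "((\<lambda>t. h (Complex a t)) has_vector_derivative - q + i * p) (at b)"
      by (rule has_vector_derivative_transform_within_open[OF _ op2]) (use ab h_eq in auto)
    have "((\<lambda>t. of_real t + \<i> * of_real b) has_vector_derivative 1) (at a)"
      by (auto intro!: derivative_eq_intros)
    then have "((\<lambda>t. Complex t b) has_vector_derivative 1) (at a)"
      by (simp add: Complex_eq[abs_def])
    from vector_derivative_diff_chain_within[OF this, of h L]
    have "((\<lambda>t. h (Complex t b)) has_vector_derivative L 1) (at a)"
      using has_derivative_at_withinI[OF L] zab by (simp add: o_def)
    with 1 have L1: "L 1 = p + i * q" by (rule vector_derivative_unique_at[symmetric])
    have "((\<lambda>t. of_real a + \<i> * of_real t) has_vector_derivative \<i>) (at b)"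
      by (auto intro!: derivative_eq_intros)
    then have "((\<lambda>t. Complex a t) has_vector_derivative \<i>) (at b)"
      by (simp add: Complex_eq[abs_def])
    from vector_derivative_diff_chain_within[OF this, of h L]
    have "((\<lambda>t. h (Complex a t)) has_vector_derivative L \<i>) (at b)"
      using has_derivative_at_withinI[OF L] zab by (simp add: o_def)
    with 2 have Li: "L \<i> = - q + i * p" by (rule vector_derivative_unique_at[symmetric])
    interpret L: bounded_linear L using has_derivative_bounded_linear[OF L] .
    have "L \<zeta> = slice_emb i \<zeta> * (p + i * q)" for \<zeta>
    proof -
      have "\<zeta> = Re \<zeta> *\<^sub>R 1 + Im \<zeta> *\<^sub>R \<i>" by (simp add: complex_eq_iff)
      then have "L \<zeta> = Re \<zeta> *\<^sub>R L 1 + Im \<zeta> *\<^sub>R L \<i>" by (metis L.add L.scaleR)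
      then show ?thesis by (simp add: L1 Li slice_emb_eq algebra_simps)
    qed
    then have "L = (\<lambda>\<zeta>. slice_emb i \<zeta> * (p + i * q))" by blast
    with L show "\<exists>d. ((\<lambda>z. f (slice_emb i z)) has_derivative (\<lambda>\<zeta>. slice_emb i \<zeta> * d)) (at z)"
      by (auto simp: h_def[abs_def])
  qed
qed

section \<open>Uniqueness, closure properties and the operator J\<close>

lemma slice_hyp_functions_eqI:
  assumes "f \<in> slice_hyp_functions" "g \<in> slice_hyp_functions"
    and "\<And>z. norm z < 1 \<Longrightarrow> f (slice_emb i z) = g (slice_emb i z)"
  shows "f = g"
proof -
  have "f = qext i (\<lambda>z. f (slice_emb i z))"
    by (rule slice_hyp_functions_restrict(2)[OF assms(1), symmetric])
  also have "\<dots> = qext i (\<lambda>z. g (slice_emb i z))" by (rule qext_cong[OF assms(3)])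
  also have "\<dots> = g" by (rule slice_hyp_functions_restrict(2)[OF assms(2)])
  finally show ?thesis .
qed

text \<open>The sum is the extension of the sum of the restrictions, so the components u and v of
  the summands need not be combined.\<close>

lemma slice_hyp_functions_add:
  assumes "f \<in> slice_hyp_functions" "g \<in> slice_hyp_functions"
  shows "(\<lambda>x. f x + g x) \<in> slice_hyp_functions"
proof -
  have "qext i (\<lambda>z. f (slice_emb i z) + g (slice_emb i z)) \<in> slice_hyp_functions"
    by (intro qext_in_slice_hyp_functions left_holomorphic_add slice_hyp_functions_restrict assms)
  then show ?thesis
    by (simp add: slice_hyp_functions_restrict(2) assms qext_add[abs_def])
qed

lemma slice_hyp_functions_mult_right:
  assumes "f \<in> slice_hyp_functions"
  shows "(\<lambda>x. f x * q) \<in> slice_hyp_functions"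
proof -
  have "qext i (\<lambda>z. f (slice_emb i z) * q) \<in> slice_hyp_functions"
    by (intro qext_in_slice_hyp_functions left_holomorphic_mult_right slice_hyp_functions_restrict assms)
  then show ?thesis
    by (simp add: slice_hyp_functions_restrict(2) assms qext_mult_right[abs_def])
qed

lemma slice_ext_eqI:
  assumes "g \<in> slice_hyp_functions" "\<And>z. norm z < 1 \<Longrightarrow> g (slice_emb i z) = h (slice_emb i z)"
  shows "slice_ext i h = g"
  unfolding slice_ext_def
proof (rule the_equality)
  show "g \<in> slice_hyp_functions \<and> (\<forall>z\<in>slice_disc i. g z = h z)"
    using assms by (auto simp: slice_disc_eq)
  fix g' assume "g' \<in> slice_hyp_functions \<and> (\<forall>z\<in>slice_disc i. g' z = h z)"
  then show "g' = g"
    using assms by (intro slice_hyp_functions_eqI) (auto simp: slice_disc_eq)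
qed

lemma opJ_in: "f \<in> slice_hyp_functions \<Longrightarrow> opJ i f \<in> slice_hyp_functions"
  and opJ_slice_emb: "f \<in> slice_hyp_functions \<Longrightarrow> norm z < 1 \<Longrightarrow> opJ i f (slice_emb i z) = i * f (slice_emb i z)"
proof -
  assume f: "f \<in> slice_hyp_functions"
  define g where "g = qext i (\<lambda>z. i * f (slice_emb i z))"
  have g: "g \<in> slice_hyp_functions"
    unfolding g_def
    by (intro qext_in_slice_hyp_functions left_holomorphic_mult_left slice_hyp_functions_restrict f)
  moreover have g': "g (slice_emb i z) = i * f (slice_emb i z)" if "norm z < 1" for z
    using that by (simp add: g_def qext_slice_emb)
  ultimately have eq: "opJ i f = g"
    unfolding opJ_def by (rule slice_ext_eqI)
  show "opJ i f \<in> slice_hyp_functions" unfolding eq by (rule g)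
  show "norm z < 1 \<Longrightarrow> opJ i f (slice_emb i z) = i * f (slice_emb i z)" unfolding eq by (rule g')
qed

end

section \<open>The slice hyperholomorphic Bergman space\<close>

lemma
  fixes x :: quat
  shows quat_mult_of_real: "x * of_real r = r *\<^sub>R x"
    and quat_of_real_mult: "of_real r * x = r *\<^sub>R x"
  by (simp_all only: of_real_def mult_scaleR_left mult_scaleR_right mult_1_left mult_1_right)

lemma qre_qcnj_mult: "qre (qcnj x * y) = inner x y"
  by (simp add: inner_quat_def)

text \<open>The optimal t is b / a. If a or b is 0 the optimum escapes to infinity or to 0; the
  explicit t chosen in these cases makes the remaining term at most N, against the lower bound 2
  N.\<close>

lemma cauchy_schwarz_optimize:
  fixes N a b :: real
  assumes "0 \<le> N" "0 \<le> a" "0 \<le> b" and le: "\<And>t. t > 0 \<Longrightarrow> 2 * N \<le> t * a\<^sup>2 + b\<^sup>2 / t"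
  shows "N \<le> a * b"
proof (rule ccontr)
  assume "\<not> N \<le> a * b"
  then have N: "a * b < N" by simp
  with assms have "N > 0" by (smt (verit) mult_nonneg_nonneg)
  consider "a = 0" | "b = 0" | "a > 0" "b > 0" using assms by linarith
  then show False
  proof cases
    case 1
    have p: "0 < b\<^sup>2 + 1" by (simp add: add_nonneg_pos)
    have "b\<^sup>2 / ((b\<^sup>2 + 1) / N) \<le> N"
      using \<open>N > 0\<close> p by (simp add: pos_divide_le_eq distrib_left)
    then show ?thesis using 1 le[of "(b\<^sup>2 + 1) / N"] \<open>N > 0\<close> p by simp
  next
    case 2
    have p: "0 < a\<^sup>2 + 1" by (simp add: add_nonneg_pos)
    then have "N / (a\<^sup>2 + 1) * a\<^sup>2 \<le> N"
      using \<open>N > 0\<close> by (simp add: pos_divide_le_eq distrib_left)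
    then show ?thesis using 2 le[of "N / (a\<^sup>2 + 1)"] \<open>N > 0\<close> p by simp
  next
    case 3
    then show ?thesis using le[of "b / a"] N by (simp add: power2_eq_square)
  qed
qed

text \<open>For a unit i, the orthogonal projection to the slice read as a complex number. It
  intertwines left multiplication by slice elements with complex multiplication, see
  \<open>slice_proj_mult\<close>.\<close>

definition slice_proj :: "quat \<Rightarrow> quat \<Rightarrow> complex" where
  "slice_proj i x = Complex (qre x) (inner x i)"

lemma bounded_linear_slice_proj: "bounded_linear (slice_proj i)"
proof -
  have "bounded_linear (\<lambda>x. qre x *\<^sub>R 1 + inner x i *\<^sub>R \<i>)"
    by (intro bounded_linear_add bounded_linear_compose[OF bounded_linear_scaleR_left]
        bounded_linear_qre bounded_linear_inner_left)
  moreover have "slice_proj i = (\<lambda>x. qre x *\<^sub>R 1 + inner x i *\<^sub>R \<i>)"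
    by (simp add: fun_eq_iff complex_eq_iff slice_proj_def)
  ultimately show ?thesis by simp
qed

text \<open>The complex functionals \<open>x \<mapsto> slice_proj i (x * q)\<close> reduce identities for
  quaternion valued left holomorphic functions to complex ones.\<close>

lemma quat_eqI_slice_proj:
  assumes "\<And>q. slice_proj i (x * q) = slice_proj i (y * q)"
  shows "x = y"
proof -
  \<comment> \<open>With q the conjugate of x - y, the real part of (x - y) q is |x - y|^2, so one
    functional suffices.\<close>
  have "qre ((x - y) * qcnj (x - y)) = 0"
    using assms[of "qcnj (x - y)"] by (simp only: slice_proj_def complex.inject left_diff_distrib) simp
  then have "inner (qcnj (x - y)) (qcnj (x - y)) = 0"
    by (simp only: qre_qcnj_mult[symmetric] qcnj_qcnj)
  then have "qcnj (qcnj (x - y)) = 0"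
    by (simp add: qcnj_def zero_quat_def)
  then show ?thesis by simp
qed

lemma (in slice_unit) slice_proj_mult: "slice_proj i (slice_emb i z * x) = z * slice_proj i x"
proof -
  interpret P: bounded_linear "slice_proj i" by (rule bounded_linear_slice_proj)
  have "qre (i * x) = - qre (qcnj i * x)"
    by simp
  then have "qre (i * x) = - inner x i"
    by (simp only: qre_qcnj_mult inner_commute)
  moreover have "inner (i * x) i = qre (qcnj x * qcnj i * i)"
    by (simp only: qcnj_mult flip: qre_qcnj_mult)
  then have "inner (i * x) i = qre x"
    by (simp add: mult.assoc)
  ultimately have "slice_proj i (i * x) = \<i> * slice_proj i x"
    by (simp add: slice_proj_def complex_eq_iff)
  then show ?thesis
    by (simp add: slice_emb_eq distrib_right P.add P.scaleR)
      (simp add: complex_eq_iff)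
qed

text \<open>Stands in for the splitting lemma: as q varies, these functions run through the complex
  components of h. Right multiplication by q does not disturb the left action of the slice, so the
  derivative becomes complex linear.\<close>

lemma (in slice_unit) slice_proj_holomorphic:
  assumes "left_holomorphic i h"
  shows "(\<lambda>z. slice_proj i (h z * q)) holomorphic_on ball 0 1"
proof (rule holomorphic_onI)
  fix z :: complex assume "z \<in> ball 0 1"
  then obtain d where "(h has_derivative (\<lambda>\<zeta>. slice_emb i \<zeta> * d)) (at z)"
    using assms unfolding left_holomorphic_def by auto
  from bounded_linear.has_derivative[OF bounded_linear_slice_proj[of i] has_derivative_mult_left[OF this, of q]]
  have "((\<lambda>z. slice_proj i (h z * q)) has_derivative (\<lambda>\<zeta>. \<zeta> * slice_proj i (d * q))) (at z)"
    by (simp add: mult.assoc slice_proj_mult)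
  then have "((\<lambda>z. slice_proj i (h z * q)) has_field_derivative slice_proj i (d * q)) (at z)"
    by (simp add: has_field_derivative_def mult_commute_abs)
  then show "(\<lambda>z. slice_proj i (h z * q)) field_differentiable at z within ball 0 1"
    using field_differentiable_at_within field_differentiable_def by blast
qed

section \<open>Scalar product and norm of the Bergman space\<close>

locale bergman = slice_unit +
  fixes \<alpha> :: real
  assumes alpha: "\<alpha> > -1"
begin

abbreviation "\<mu> \<equiv> disc_measure \<alpha>"
abbreviation "H \<equiv> bergman_space \<alpha> i"
abbreviation "ip \<equiv> bergman_inner \<alpha> i"
abbreviation "nrm \<equiv> bergman_norm \<alpha> i"

text \<open>The slice is closed, being the fixed point set of the orthogonal projection to the span
  of 1 and i.\<close>

lemma slice_disc_borel [measurable]: "slice_disc i \<in> sets borel"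
proof -
  have "qslice i = {x. x = qre x *\<^sub>R 1 + inner x i *\<^sub>R i}"
  proof safe
    fix x assume "x \<in> qslice i"
    then obtain a b where "x = of_real a + i * of_real b" by (auto simp: qslice_def)
    then show "x = qre x *\<^sub>R 1 + inner x i *\<^sub>R i"
      by (simp add: of_real_def inner_add_left dot_square_norm)
  next
    fix x assume "x = qre x *\<^sub>R 1 + inner x i *\<^sub>R i"
    then show "x \<in> qslice i"
      unfolding qslice_def
      by (intro CollectI exI[of _ "qre x"] exI[of _ "inner x i"] conjI TrueI)
        (simp only: of_real_def mult_scaleR_right mult_1_right)
  qed
  then have "closed (qslice i)"
    by (simp only:)
      (intro closed_Collect_eq continuous_on_add continuous_on_scaleR continuous_on_const continuous_on_inner
        continuous_on_id linear_continuous_on[OF bounded_linear_qre])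
  then show ?thesis
    unfolding slice_disc_def qDisc_def by auto
qed

lemma slice_emb_in_slice_disc: "slice_emb i z \<in> slice_disc i \<longleftrightarrow> z \<in> ball 0 1"
  unfolding slice_disc_eq using slice_emb_inj by (auto dest: slice_emb_inj)

lemma bergman_measure_eq: "bergman_measure \<alpha> i = distr \<mu> borel (slice_emb i)"
proof -
  define W where "W z = ennreal (indicator (slice_disc i) z * ((\<alpha> + 1) / pi * (1 - (norm z)\<^sup>2) powr \<alpha>))" for z
  have [measurable]: "W \<in> borel_measurable borel" unfolding W_def by measurable
  have "W (slice_emb i z) = ennreal (disc_weight \<alpha> z)" for z
    using slice_emb_in_slice_disc[of z] by (simp add: W_def disc_weight_def indicator_def)
  moreover have "density (distr lborel borel (slice_emb i)) W = distr (density lborel (\<lambda>z. W (slice_emb i z))) borel (slice_emb i)"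
    by (rule density_distr) simp_all
  ultimately show ?thesis
    by (simp add: bergman_measure_def slice_lborel_def disc_measure_def W_def[abs_def] slice_emb_def[abs_def])
qed

lemma slice_hyp_measurable:
  assumes "f \<in> slice_hyp_functions"
  shows "f \<in> borel_measurable borel"
proof -
  have "continuous_on qDisc f"
    using assms by (auto simp: slice_hyp_functions_def slice_hyperholomorphic_def intro: differentiable_imp_continuous_on)
  then have "(\<lambda>x. indicator qDisc x *\<^sub>R f x) \<in> borel_measurable borel"
    by (intro borel_measurable_continuous_on_indicator) (simp_all add: qDisc_def)
  also have "(\<lambda>x. indicator qDisc x *\<^sub>R f x) = f"
    using assms by (auto simp: slice_hyp_functions_def indicator_def)
  finally show ?thesis .
qed

lemma slice_hyp_emb_measurable:
  assumes "f \<in> slice_hyp_functions"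
  shows "(\<lambda>z. f (slice_emb i z)) \<in> borel_measurable borel"
  using measurable_compose[OF measurable_slice_emb slice_hyp_measurable[OF assms]] .

lemma measurable_qcnj [measurable]: "qcnj \<in> borel_measurable borel"
  by (intro borel_measurable_continuous_onI linear_continuous_on bounded_linear_qcnj)

lemma bergman_space_iff:
  "f \<in> H \<longleftrightarrow> f \<in> slice_hyp_functions \<and> integrable \<mu> (\<lambda>z. (norm (f (slice_emb i z)))\<^sup>2)"
proof (cases "f \<in> slice_hyp_functions")
  case True
  then have [measurable]: "f \<in> borel_measurable borel" by (rule slice_hyp_measurable)
  show ?thesis
    unfolding bergman_space_def bergman_measure_eq by (simp add: True integrable_distr_eq)
qed (simp add: bergman_space_def)

lemma bergman_spaceD:
  assumes "f \<in> H"
  shows "f \<in> slice_hyp_functions" "integrable \<mu> (\<lambda>z. (norm (f (slice_emb i z)))\<^sup>2)"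
    "(\<lambda>z. f (slice_emb i z)) \<in> borel_measurable borel"
  using assms slice_hyp_emb_measurable by (auto simp: bergman_space_iff)

lemma bergman_inner_eq:
  assumes "f \<in> H" "g \<in> H"
  shows "ip f g = (\<integral>z. qcnj (f (slice_emb i z)) * g (slice_emb i z) \<partial>\<mu>)"
proof -
  have [measurable]: "f \<in> borel_measurable borel" "g \<in> borel_measurable borel"
    using assms bergman_spaceD(1) slice_hyp_measurable by auto
  show ?thesis
    unfolding bergman_inner_def bergman_measure_eq by (simp add: integral_distr)
qed

lemma bergman_inner_integrable:
  assumes "f \<in> H" "g \<in> H"
  shows "integrable \<mu> (\<lambda>z. qcnj (f (slice_emb i z)) * g (slice_emb i z))"
proof -
  note [measurable] = bergman_spaceD(3)[OF assms(1)] bergman_spaceD(3)[OF assms(2)]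
  show ?thesis
  proof (rule Bochner_Integration.integrable_bound)
    show "integrable \<mu> (\<lambda>z. (norm (f (slice_emb i z)))\<^sup>2 + (norm (g (slice_emb i z)))\<^sup>2)"
      using assms by (intro Bochner_Integration.integrable_add bergman_spaceD)
    show "AE z in \<mu>. norm (qcnj (f (slice_emb i z)) * g (slice_emb i z))
      \<le> norm ((norm (f (slice_emb i z)))\<^sup>2 + (norm (g (slice_emb i z)))\<^sup>2)"
    proof (rule AE_I2)
      fix z
      have "2 * (norm (f (slice_emb i z)) * norm (g (slice_emb i z)))
        \<le> (norm (f (slice_emb i z)))\<^sup>2 + (norm (g (slice_emb i z)))\<^sup>2"
        using sum_squares_bound by (simp add: mult.assoc)
      moreover have "0 \<le> norm (f (slice_emb i z)) * norm (g (slice_emb i z))" by simp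
      ultimately show "norm (qcnj (f (slice_emb i z)) * g (slice_emb i z))
        \<le> norm ((norm (f (slice_emb i z)))\<^sup>2 + (norm (g (slice_emb i z)))\<^sup>2)"
        unfolding norm_mult norm_qcnj real_norm_def by linarith
    qed
  qed measurable
qed

lemma bergman_space_add:
  assumes "f \<in> H" "g \<in> H"
  shows "(\<lambda>x. f x + g x) \<in> H"
  unfolding bergman_space_iff
proof
  note [measurable] = bergman_spaceD(3)[OF assms(1)] bergman_spaceD(3)[OF assms(2)]
  show "(\<lambda>x. f x + g x) \<in> slice_hyp_functions"
    using assms by (intro slice_hyp_functions_add bergman_spaceD)
  show "integrable \<mu> (\<lambda>z. (norm (f (slice_emb i z) + g (slice_emb i z)))\<^sup>2)"
  proof (rule Bochner_Integration.integrable_bound)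
    show "integrable \<mu> (\<lambda>z. 2 * (norm (f (slice_emb i z)))\<^sup>2 + 2 * (norm (g (slice_emb i z)))\<^sup>2)"
      using bergman_spaceD(2)[OF assms(1)] bergman_spaceD(2)[OF assms(2)] by simp
    show "AE z in \<mu>. norm ((norm (f (slice_emb i z) + g (slice_emb i z)))\<^sup>2)
      \<le> norm (2 * (norm (f (slice_emb i z)))\<^sup>2 + 2 * (norm (g (slice_emb i z)))\<^sup>2)"
    proof (rule AE_I2)
      fix z
      let ?a = "norm (f (slice_emb i z))" and ?b = "norm (g (slice_emb i z))"
      have "(norm (f (slice_emb i z) + g (slice_emb i z)))\<^sup>2 \<le> (?a + ?b)\<^sup>2"
        by (intro power_mono norm_triangle_ineq) simp
      also have "\<dots> \<le> 2 * ?a\<^sup>2 + 2 * ?b\<^sup>2"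
        using sum_squares_bound[of ?a ?b] by (simp add: power2_sum)
      finally show "norm ((norm (f (slice_emb i z) + g (slice_emb i z)))\<^sup>2) \<le> norm (2 * ?a\<^sup>2 + 2 * ?b\<^sup>2)"
        by simp
    qed
  qed measurable
qed

lemma bergman_space_mult_right:
  assumes "f \<in> H"
  shows "(\<lambda>x. f x * q) \<in> H"
  using assms bergman_spaceD(2)[OF assms]
  by (simp add: bergman_space_iff slice_hyp_functions_mult_right norm_mult power_mult_distrib)

lemma bergman_space_diff: "f \<in> H \<Longrightarrow> g \<in> H \<Longrightarrow> (\<lambda>x. f x - g x) \<in> H"
  using bergman_space_add[of f "\<lambda>x. g x * (- 1)"] bergman_space_mult_right[of g "- 1"] by simp

lemma ip_add_right:
  assumes "f \<in> H" "g \<in> H" "h \<in> H"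
  shows "ip f (\<lambda>x. g x + h x) = ip f g + ip f h"
  using assms by (simp add: bergman_inner_eq bergman_space_add distrib_left bergman_inner_integrable)

lemma ip_mult_right:
  assumes "f \<in> H" "g \<in> H"
  shows "ip f (\<lambda>x. g x * q) = ip f g * q"
  using assms by (simp add: bergman_inner_eq bergman_space_mult_right bergman_inner_integrable flip: mult.assoc)

lemma ip_cnj:
  assumes "f \<in> H" "g \<in> H"
  shows "ip g f = qcnj (ip f g)"
  using integral_bounded_linear[OF bounded_linear_qcnj bergman_inner_integrable[OF assms]] assms
  by (simp add: bergman_inner_eq qcnj_mult)

lemma ip_add_left:
  assumes "f \<in> H" "g \<in> H" "h \<in> H"
  shows "ip (\<lambda>x. f x + g x) h = ip f h + ip g h"
  using assms by (simp add: ip_cnj[of h] ip_add_right qcnj_add bergman_space_add)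

lemma ip_mult_left:
  assumes "f \<in> H" "g \<in> H"
  shows "ip (\<lambda>x. f x * q) g = qcnj q * ip f g"
  using assms by (simp add: ip_cnj[of g] ip_mult_right qcnj_mult bergman_space_mult_right)

lemma ip_diff_right:
  assumes "f \<in> H" "g \<in> H" "h \<in> H"
  shows "ip f (\<lambda>x. g x - h x) = ip f g - ip f h"
  using ip_add_right[of f g "\<lambda>x. h x * (- 1)"] ip_mult_right[of f h "- 1"] assms
    bergman_space_mult_right[of h "- 1"] by simp

lemma ip_diff_left:
  assumes "f \<in> H" "g \<in> H" "h \<in> H"
  shows "ip (\<lambda>x. f x - g x) h = ip f h - ip g h"
  using ip_add_left[of f "\<lambda>x. g x * (- 1)" h] ip_mult_left[of g h "- 1"] assms
    bergman_space_mult_right[of g "- 1"] by (simp add: quat_eq_iff)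

lemma ip_self: "f \<in> H \<Longrightarrow> ip f f = of_real (\<integral>z. (norm (f (slice_emb i z)))\<^sup>2 \<partial>\<mu>)"
  using integral_bounded_linear[OF bounded_linear_of_real[where 'a = quat] bergman_spaceD(2)[of f]]
  by (simp add: bergman_inner_eq qcnj_mult_self)

lemma nrm_eq: "f \<in> H \<Longrightarrow> nrm f = sqrt (\<integral>z. (norm (f (slice_emb i z)))\<^sup>2 \<partial>\<mu>)"
  by (simp add: bergman_norm_def ip_self)

lemma nrm_nonneg [simp]: "f \<in> H \<Longrightarrow> 0 \<le> nrm f"
  by (simp add: nrm_eq)

lemma nrm_sq: "f \<in> H \<Longrightarrow> (nrm f)\<^sup>2 = (\<integral>z. (norm (f (slice_emb i z)))\<^sup>2 \<partial>\<mu>)"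
  by (simp add: nrm_eq)

lemma ip_self_nrm: "f \<in> H \<Longrightarrow> ip f f = of_real ((nrm f)\<^sup>2)"
  by (simp add: nrm_sq ip_self)

lemma nrm_mult: 
  assumes "f \<in> H"
  shows "nrm (\<lambda>x. f x * q) = nrm f * norm q"
proof -
  have "(nrm (\<lambda>x. f x * q))\<^sup>2 = (nrm f * norm q)\<^sup>2"
    using assms by (simp add: nrm_sq bergman_space_mult_right norm_mult power_mult_distrib)
  then show ?thesis
    using assms by (simp add: bergman_space_mult_right)
qed

text \<open>The pointwise bound 2 |f| |g| \<le> t |f|^2 + |g|^2 / t is integrated for each t, and t
  is optimized afterwards. Only real quantities are involved, so noncommuting scalars cause no
  trouble.\<close>

lemma ip_cauchy_schwarz:
  assumes fH: "f \<in> H" and gH: "g \<in> H"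
  shows "norm (ip f g) \<le> nrm f * nrm g"
proof (rule cauchy_schwarz_optimize)
  fix t :: real assume t: "t > 0"
  have int: "integrable \<mu> (\<lambda>z. (t * (norm (f (slice_emb i z)))\<^sup>2 + (norm (g (slice_emb i z)))\<^sup>2 / t) / 2)"
    using bergman_spaceD(2)[OF fH] bergman_spaceD(2)[OF gH] by simp
  have "norm (ip f g) \<le> (\<integral>z. (t * (norm (f (slice_emb i z)))\<^sup>2 + (norm (g (slice_emb i z)))\<^sup>2 / t) / 2 \<partial>\<mu>)"
    unfolding bergman_inner_eq[OF assms]
  proof (rule Bochner_Integration.integral_norm_bound_integral[OF bergman_inner_integrable[OF assms] int])
    fix z
    let ?a = "norm (f (slice_emb i z))" and ?b = "norm (g (slice_emb i z))"
    have "0 \<le> (t * ?a - ?b)\<^sup>2 / t" using t by simp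
    also have "(t * ?a - ?b)\<^sup>2 / t = t * ?a\<^sup>2 + ?b\<^sup>2 / t - 2 * (?a * ?b)"
      using t by (simp add: power2_eq_square field_simps)
    finally show "norm (qcnj (f (slice_emb i z)) * g (slice_emb i z)) \<le> (t * ?a\<^sup>2 + ?b\<^sup>2 / t) / 2"
      by (simp add: norm_mult)
  qed
  also have "\<dots> = (t * (nrm f)\<^sup>2 + (nrm g)\<^sup>2 / t) / 2"
    using bergman_spaceD(2)[OF fH] bergman_spaceD(2)[OF gH] by (simp add: nrm_sq fH gH)
  finally show "2 * norm (ip f g) \<le> t * (nrm f)\<^sup>2 + (nrm g)\<^sup>2 / t" by simp
qed (use assms in auto)

lemma nrm_add_sq:
  assumes "f \<in> H" "g \<in> H"
  shows "(nrm (\<lambda>x. f x + g x))\<^sup>2 = (nrm f)\<^sup>2 + (nrm g)\<^sup>2 + 2 * qre (ip f g)"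
    "(nrm (\<lambda>x. f x - g x))\<^sup>2 = (nrm f)\<^sup>2 + (nrm g)\<^sup>2 - 2 * qre (ip f g)"
proof -
  have sq: "(nrm h)\<^sup>2 = qre (ip h h)" if "h \<in> H" for h
    unfolding ip_self_nrm[OF that] quat_of_real_sel ..
  have "ip g f = qcnj (ip f g)" using assms by (rule ip_cnj)
  then show "(nrm (\<lambda>x. f x + g x))\<^sup>2 = (nrm f)\<^sup>2 + (nrm g)\<^sup>2 + 2 * qre (ip f g)"
    "(nrm (\<lambda>x. f x - g x))\<^sup>2 = (nrm f)\<^sup>2 + (nrm g)\<^sup>2 - 2 * qre (ip f g)"
    using assms by (simp_all add: sq bergman_space_add bergman_space_diff ip_add_left ip_add_right ip_diff_left ip_diff_right)
qed

section \<open>The reproducing kernel in closed form\<close>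

definition kern :: "complex \<Rightarrow> quat \<Rightarrow> quat" where
  "kern w = qext i (\<lambda>z. slice_emb i ((1 - z * cnj w) powr of_real (- (\<alpha> + 2))))"

text \<open>The first bound keeps the base of the complex power off its branch cut, the second keeps
  it away from 0 uniformly in z, so that \<open>kern w\<close> is bounded on the disc.\<close>

lemma kernel_Re_pos:
  assumes "norm z < 1" "norm w < 1"
  shows "0 < Re (1 - z * cnj w)" "1 - norm w \<le> norm (1 - z * cnj w)"
proof -
  have "norm (z * cnj w) \<le> 1 * norm w"
    using assms by (simp add: norm_mult mult_left_le_one_le)
  with complex_Re_le_cmod[of "z * cnj w"] norm_triangle_ineq2[of 1 "z * cnj w"] assms
  show "0 < Re (1 - z * cnj w)" "1 - norm w \<le> norm (1 - z * cnj w)" by auto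
qed

lemma kern_slice_emb:
  "norm z < 1 \<Longrightarrow> kern w (slice_emb i z) = slice_emb i ((1 - z * cnj w) powr of_real (- (\<alpha> + 2)))"
  by (simp add: kern_def qext_slice_emb)

lemma kern_in_space:
  assumes w: "norm w < 1"
  shows "kern w \<in> H"
  unfolding bergman_space_iff
proof
  have "(\<lambda>z. (1 - z * cnj w) powr of_real (- (\<alpha> + 2))) holomorphic_on ball 0 1"
    using kernel_Re_pos(1)[OF _ w]
    by (intro holomorphic_intros) (force simp: complex_nonpos_Reals_iff)
  then show S: "kern w \<in> slice_hyp_functions"
    unfolding kern_def by (intro qext_in_slice_hyp_functions left_holomorphic_slice_emb)
  note [measurable] = slice_hyp_emb_measurable[OF S]
  show "integrable \<mu> (\<lambda>z. (norm (kern w (slice_emb i z)))\<^sup>2)"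
  proof (rule integrable_disc_bounded[OF alpha])
    show "(\<lambda>z. (norm (kern w (slice_emb i z)))\<^sup>2) \<in> borel_measurable borel" by measurable
    fix z :: complex assume z: "norm z < 1"
    have "norm (kern w (slice_emb i z)) = norm (1 - z * cnj w) powr (- (\<alpha> + 2))"
      using z by (simp add: kern_slice_emb norm_powr_real_powr')
    also have "\<dots> \<le> (1 - norm w) powr (- (\<alpha> + 2))"
      using kernel_Re_pos(2)[OF z w] w alpha by (intro powr_mono2') auto
    finally show "norm ((norm (kern w (slice_emb i z)))\<^sup>2) \<le> ((1 - norm w) powr (- (\<alpha> + 2)))\<^sup>2"
      by (simp add: power_mono)
  qed
qed

lemma kern_reproducing:
  assumes w: "norm w < 1" and f: "f \<in> H"
  shows "ip (kern w) f = f (slice_emb i w)"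
proof (rule quat_eqI_slice_proj)
  fix q
  note [measurable] = bergman_spaceD(3)[OF f] bergman_spaceD(3)[OF kern_in_space[OF w]]
  interpret P: bounded_linear "slice_proj i" by (rule bounded_linear_slice_proj)
  define K where "K z = (1 - z * cnj w) powr of_real (- (\<alpha> + 2))" for z
  define F where "F z = slice_proj i (f (slice_emb i z) * q)" for z
  have holF: "F holomorphic_on ball 0 1"
    unfolding F_def
    by (intro slice_proj_holomorphic slice_hyp_functions_restrict bergman_spaceD[OF f])
  \<comment> \<open>The complex reproducing formula asks for an integrable function. Since the
    measure is finite, square integrability of f is enough.\<close>
  have "integrable \<mu> (\<lambda>z. norm (f (slice_emb i z)))"
  proof (rule Bochner_Integration.integrable_bound)
    show "integrable \<mu> (\<lambda>z. 1 + (norm (f (slice_emb i z)))\<^sup>2)"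
      using finite_measure.integrable_const[OF finite_disc_measure[OF alpha]] bergman_spaceD(2)[OF f]
      by (rule Bochner_Integration.integrable_add)
    show "AE z in \<mu>. norm (norm (f (slice_emb i z))) \<le> norm (1 + (norm (f (slice_emb i z)))\<^sup>2)"
    proof (rule AE_I2)
      fix z
      have "2 * 1 * norm (f (slice_emb i z)) \<le> 1\<^sup>2 + (norm (f (slice_emb i z)))\<^sup>2"
        by (rule sum_squares_bound)
      then have "norm (f (slice_emb i z)) \<le> 1 + (norm (f (slice_emb i z)))\<^sup>2"
        using norm_ge_zero[of "f (slice_emb i z)"] unfolding power_one mult_1_right by linarith
      then show "norm (norm (f (slice_emb i z))) \<le> norm (1 + (norm (f (slice_emb i z)))\<^sup>2)"
        by simp
    qed
  qed measurable
  then have "integrable \<mu> (\<lambda>z. f (slice_emb i z))"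
    by (rule Bochner_Integration.integrable_bound) simp_all
  then have intF: "integrable \<mu> F"
    unfolding F_def
    by (intro integrable_bounded_linear[OF bounded_linear_slice_proj] Bochner_Integration.integrable_mult_left)
  have "slice_proj i (ip (kern w) f * q) = slice_proj i (\<integral>z. qcnj (kern w (slice_emb i z)) * f (slice_emb i z) * q \<partial>\<mu>)"
    by (simp add: bergman_inner_eq kern_in_space w f bergman_inner_integrable)
  also have "\<dots> = (\<integral>z. slice_proj i (qcnj (kern w (slice_emb i z)) * f (slice_emb i z) * q) \<partial>\<mu>)"
    by (rule integral_bounded_linear[OF bounded_linear_slice_proj, symmetric])
      (simp add: kern_in_space w f bergman_inner_integrable)
  also have "\<dots> = (\<integral>z. cnj (K z) * F z \<partial>\<mu>)"
  proof (rule integral_cong_AE)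
    have [measurable]: "F \<in> borel_measurable borel"
      using borel_measurable_integrable[OF intF] by (simp add: measurable_def)
    have [measurable]: "slice_proj i \<in> borel_measurable borel"
      by (intro borel_measurable_continuous_onI linear_continuous_on bounded_linear_slice_proj)
    show "(\<lambda>z. slice_proj i (qcnj (kern w (slice_emb i z)) * f (slice_emb i z) * q)) \<in> borel_measurable \<mu>"
      "(\<lambda>z. cnj (K z) * F z) \<in> borel_measurable \<mu>"
      unfolding K_def by measurable
    show "AE z in \<mu>. slice_proj i (qcnj (kern w (slice_emb i z)) * f (slice_emb i z) * q) = cnj (K z) * F z"
    proof (rule eventually_mono[OF AE_disc_measure])
      fix z :: complex assume "norm z < 1"
      then have "qcnj (kern w (slice_emb i z)) = slice_emb i (cnj (K z))"
        by (simp add: kern_slice_emb K_def slice_emb_cnj)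
      then show "slice_proj i (qcnj (kern w (slice_emb i z)) * f (slice_emb i z) * q) = cnj (K z) * F z"
        by (simp add: F_def mult.assoc slice_proj_mult)
    qed
  qed
  also have "\<dots> = F w"
    unfolding K_def by (rule disc_kernel_reproducing[OF alpha holF intF w])
  finally show "slice_proj i (ip (kern w) f * q) = slice_proj i (f (slice_emb i w) * q)"
    by (simp add: F_def)
qed

lemma bergman_kernel_eq:
  assumes w: "norm w < 1"
  shows "bergman_kernel \<alpha> i (slice_emb i w) = kern w"
  unfolding bergman_kernel_def
proof (rule the_equality)
  show "kern w \<in> H \<and> (\<forall>f\<in>H. f (slice_emb i w) = ip (kern w) f)"
    using w by (simp add: kern_in_space kern_reproducing)
  fix K assume K: "K \<in> H \<and> (\<forall>f\<in>H. f (slice_emb i w) = ip K f)"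
  show "K = kern w"
  proof (rule slice_hyp_functions_eqI)
    show "K \<in> slice_hyp_functions" "kern w \<in> slice_hyp_functions"
      using K kern_in_space[OF w] bergman_spaceD(1) by auto
    fix z :: complex assume z: "norm z < 1"
    \<comment> \<open>K and \<open>kern w\<close> both represent evaluation at w, hence have the
      same scalar product with \<open>kern z\<close>; conjugate symmetry turns this into equal
      values at z.\<close>
    have "K (slice_emb i z) = ip (kern z) K" using K z by (simp add: kern_reproducing)
    also have "\<dots> = qcnj (ip K (kern z))" using K z by (intro ip_cnj) (auto simp: kern_in_space)
    also have "ip K (kern z) = ip (kern w) (kern z)"
      using K z w by (simp add: kern_in_space kern_reproducing)
    also have "qcnj \<dots> = ip (kern z) (kern w)"
      using z w by (simp add: ip_cnj[symmetric] kern_in_space)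
    finally show "K (slice_emb i z) = kern w (slice_emb i z)"
      using z w by (simp add: kern_reproducing kern_in_space)
  qed
qed


definition kern_value :: "complex \<Rightarrow> complex \<Rightarrow> complex" where
  "kern_value z w = (1 - z * cnj w) powr of_real (- (\<alpha> + 2))"

lemma ip_kern_kern:
  "norm z < 1 \<Longrightarrow> norm w < 1 \<Longrightarrow> ip (kern z) (kern w) = slice_emb i (kern_value z w)"
  by (simp add: kern_reproducing kern_in_space kern_slice_emb kern_value_def)

lemma norm_kern_value: "norm (kern_value z w) = norm (1 - z * cnj w) powr (- (\<alpha> + 2))"
  by (simp add: kern_value_def norm_powr_real_powr')

lemma nrm_kern_sq:
  assumes w: "norm w < 1"
  shows "(nrm (kern w))\<^sup>2 = (1 - (norm w)\<^sup>2) powr (- (\<alpha> + 2))"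
proof -
  have p: "0 < 1 - (norm w)\<^sup>2" using w by (simp add: abs_square_less_1)
  have e: "1 - w * cnj w = of_real (1 - (norm w)\<^sup>2)"
    by (simp only: complex_norm_square[symmetric] of_real_diff of_real_1)
  have "(of_real ((nrm (kern w))\<^sup>2) :: quat) = slice_emb i (kern_value w w)"
    using w by (simp only: ip_self_nrm[symmetric] ip_kern_kern kern_in_space)
  then have "(nrm (kern w))\<^sup>2 = norm (kern_value w w)"
    by (metis norm_slice_emb norm_of_real abs_of_nonneg zero_le_power2)
  also have "\<dots> = (1 - (norm w)\<^sup>2) powr (- (\<alpha> + 2))"
    unfolding norm_kern_value e norm_of_real using p by simp
  finally show ?thesis .
qed

lemma nrm_kern_pos: "norm w < 1 \<Longrightarrow> 0 < nrm (kern w)"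
  using nrm_kern_sq[of w] nrm_nonneg[OF kern_in_space[of w]]
  by (cases "nrm (kern w) = 0") (auto simp: abs_square_eq_1)

section \<open>Normalized kernels and their scalar products\<close>

abbreviation nkern :: "complex \<Rightarrow> quat \<Rightarrow> quat" where
  "nkern w \<equiv> normalized_kernel \<alpha> i (slice_emb i w)"

lemma nkern_eq: "norm w < 1 \<Longrightarrow> nkern w = (\<lambda>x. kern w x * of_real (inverse (nrm (kern w))))"
  by (simp add: normalized_kernel_def bergman_kernel_eq of_real_def)

lemma nkern_in_space: "norm w < 1 \<Longrightarrow> nkern w \<in> H"
  by (simp add: nkern_eq bergman_space_mult_right kern_in_space)

lemma nrm_nkern: "norm w < 1 \<Longrightarrow> nrm (nkern w) = 1"
  using nrm_kern_pos[of w] by (simp add: nkern_eq nrm_mult kern_in_space norm_inverse)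

lemma ip_nkern:
  "norm w < 1 \<Longrightarrow> f \<in> H \<Longrightarrow> ip (nkern w) f = of_real (inverse (nrm (kern w))) * f (slice_emb i w)"
  by (simp only: nkern_eq ip_mult_left kern_in_space kern_reproducing qcnj_of_real)

lemma ip_nkern_nkern:
  assumes "norm z < 1" "norm w < 1"
  obtains \<gamma> where "ip (nkern z) (nkern w) = slice_emb i \<gamma>" "\<gamma> \<noteq> 0"
    "(norm \<gamma>)\<^sup>2 = (1 - (norm (z - w) / norm (1 - z * cnj w))\<^sup>2) powr (\<alpha> + 2)"
    "(norm (z - w) / norm (1 - z * cnj w))\<^sup>2 < 1"
proof -
  define \<gamma> where "\<gamma> = (inverse (nrm (kern z)) * inverse (nrm (kern w))) *\<^sub>R kern_value z w"
  note p = nrm_kern_pos[OF assms(1)] nrm_kern_pos[OF assms(2)]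
  have n: "norm (1 - z * cnj w) > 0" 
    using kernel_Re_pos(1)[OF assms] complex_Re_le_cmod[of "1 - z * cnj w"] by linarith
  have q: "0 < 1 - (norm z)\<^sup>2" "0 < 1 - (norm w)\<^sup>2" using assms by (simp_all add: abs_square_less_1)
  \<comment> \<open>The classical identity behind the pseudo-hyperbolic metric. Divided by |1 - z
    cnj w|^2 it expresses the squared modulus of the normalized scalar product by \<rho>; positivity
    of the left side gives \<rho> < 1.\<close>
  have "(1 - (norm z)\<^sup>2) * (1 - (norm w)\<^sup>2) = (norm (1 - z * cnj w))\<^sup>2 - (norm (z - w))\<^sup>2"
    by (simp add: cmod_power2) (simp add: power2_eq_square algebra_simps)
  then have rho: "(1 - (norm z)\<^sup>2) * (1 - (norm w)\<^sup>2) / (norm (1 - z * cnj w))\<^sup>2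
      = 1 - (norm (z - w) / norm (1 - z * cnj w))\<^sup>2"
    using n by (simp add: diff_divide_distrib power_divide)
  show thesis
  proof (rule that)
    show "ip (nkern z) (nkern w) = slice_emb i \<gamma>"
    proof -
      have "ip (nkern z) (nkern w) = of_real (inverse (nrm (kern z))) *
          (slice_emb i (kern_value z w) * of_real (inverse (nrm (kern w))))"
        unfolding ip_nkern[OF assms(1) nkern_in_space[OF assms(2)]]
        unfolding nkern_eq[OF assms(2)] kern_slice_emb[OF assms(1)] kern_value_def ..
      then show ?thesis
        by (simp only: \<gamma>_def slice_emb_scaleR quat_mult_of_real quat_of_real_mult scaleR_scaleR)
    qed
    have "norm (kern_value z w) > 0" using n by (simp add: norm_kern_value)
    then show "\<gamma> \<noteq> 0" using p by (auto simp: \<gamma>_def)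
    have "(norm \<gamma>)\<^sup>2 = inverse ((nrm (kern z))\<^sup>2) * inverse ((nrm (kern w))\<^sup>2) * (norm (kern_value z w))\<^sup>2"
      using p by (simp add: \<gamma>_def power_mult_distrib power_inverse)
    also have "\<dots> = (1 - (norm z)\<^sup>2) powr (\<alpha> + 2) * (1 - (norm w)\<^sup>2) powr (\<alpha> + 2)
        * ((norm (1 - z * cnj w))\<^sup>2) powr (- (\<alpha> + 2))"
      using n by (simp only: nrm_kern_sq assms norm_kern_value powr_minus inverse_inverse_eq power_inverse)
        (simp add: powr_power powr_powr power2_eq_square powr_mult)
    also have "\<dots> = ((1 - (norm z)\<^sup>2) * (1 - (norm w)\<^sup>2) / (norm (1 - z * cnj w))\<^sup>2) powr (\<alpha> + 2)"
      using q n by (simp only: powr_minus_divide) (simp add: powr_mult powr_divide)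
    finally show "(norm \<gamma>)\<^sup>2 = (1 - (norm (z - w) / norm (1 - z * cnj w))\<^sup>2) powr (\<alpha> + 2)"
      unfolding rho .
    have "0 < (1 - (norm z)\<^sup>2) * (1 - (norm w)\<^sup>2) / (norm (1 - z * cnj w))\<^sup>2"
      using q n by simp
    then show "(norm (z - w) / norm (1 - z * cnj w))\<^sup>2 < 1"
      unfolding rho by simp
  qed
qed

lemma pseudo_hyp_dist_emb:
  "pseudo_hyp_dist (slice_emb i z) (slice_emb i w) = norm (z - w) / norm (1 - z * cnj w)"
  unfolding pseudo_hyp_dist_def
  by (metis norm_slice_emb slice_emb_1 slice_emb_cnj slice_emb_diff slice_emb_mult)

section \<open>Bounded operators and the operator norm\<close>

lemma bounded_right_linearD:
  assumes "bounded_right_linear \<alpha> i T"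
  shows "f \<in> H \<Longrightarrow> T f \<in> H"
    "f \<in> H \<Longrightarrow> g \<in> H \<Longrightarrow> T (\<lambda>x. f x + g x) = (\<lambda>x. T f x + T g x)"
    "f \<in> H \<Longrightarrow> T (\<lambda>x. f x * q) = (\<lambda>x. T f x * q)"
  using assms by (auto simp: bounded_right_linear_def)

lemma bounded_right_linear_diff:
  assumes "bounded_right_linear \<alpha> i T" "f \<in> H" "g \<in> H"
  shows "T (\<lambda>x. f x - g x) = (\<lambda>x. T f x - T g x)"
  using bounded_right_linearD(2)[OF assms(1), of f "\<lambda>x. g x * (- 1)"]
    bounded_right_linearD(3)[OF assms(1), of g "- 1"] assms bergman_space_mult_right[of g "- 1"] by simp

lemma operator_norm_bound:
  assumes T: "bounded_right_linear \<alpha> i T" and f: "f \<in> H"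
  shows "nrm (T f) \<le> operator_norm \<alpha> i T * nrm f"
proof -
  obtain M where M: "\<And>g. g \<in> H \<Longrightarrow> nrm (T g) \<le> M * nrm g"
    using T unfolding bounded_right_linear_def by blast
  have bdd: "bdd_above ((\<lambda>g. nrm (T g)) ` {g \<in> H. nrm g \<le> 1})"
  proof (rule bdd_aboveI2)
    fix g assume "g \<in> {g \<in> H. nrm g \<le> 1}"
    then have g: "g \<in> H" "nrm g \<le> 1" by auto
    have "nrm (T g) \<le> M * nrm g" by (rule M[OF g(1)])
    \<comment> \<open>The bound M in the definition may be any real number, hence the absolute
      value.\<close>
    also have "\<dots> \<le> \<bar>M\<bar> * 1" using g by (intro mult_mono) auto
    finally show "nrm (T g) \<le> \<bar>M\<bar>" by simp
  qed
  show ?thesis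
  proof (cases "nrm f = 0")
    case True
    then show ?thesis using M[OF f] by simp
  next
    case False
    then have p: "nrm f > 0" using nrm_nonneg[OF f] by linarith
    define g where "g = (\<lambda>x. f x * of_real (inverse (nrm f)))"
    have g: "g \<in> H" "nrm g = 1"
      using p f by (simp_all add: g_def bergman_space_mult_right nrm_mult norm_inverse)
    have "nrm (T g) \<le> operator_norm \<alpha> i T"
      unfolding operator_norm_def by (rule cSUP_upper[OF _ bdd]) (simp add: g)
    also have "nrm (T g) = nrm (T f) / nrm f"
      using p f bounded_right_linearD[OF T]
      by (simp add: g_def nrm_mult norm_inverse divide_inverse)
    finally show ?thesis using p by (simp add: divide_le_eq)
  qed
qed

lemma operator_norm_le:
  assumes "\<And>f. f \<in> H \<Longrightarrow> nrm (T f) \<le> M * nrm f" "0 \<le> M"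
  shows "operator_norm \<alpha> i T \<le> M"
  unfolding operator_norm_def
proof (rule cSUP_least)
  \<comment> \<open>Bounding a real supremum from above requires a nonempty index set.\<close>
  have "nkern 0 \<in> {f \<in> H. nrm f \<le> 1}" using nkern_in_space[of 0] nrm_nkern[of 0] by simp
  then show "{f \<in> H. nrm f \<le> 1} \<noteq> {}" by blast
  fix f assume f: "f \<in> {f \<in> H. nrm f \<le> 1}"
  then have "nrm (T f) \<le> M * nrm f" using assms by simp
  also have "\<dots> \<le> M * 1" using f assms by (intro mult_left_mono) auto
  finally show "nrm (T f) \<le> M" by simp
qed


text \<open>On the slice k_w has values in the slice, so J k_w = k_w i. Right linearity gives T (k_w
  i) = (T k_w) i, and commutation with J gives J (T k_w) for the same function; at w this says that
  X = (T k_w)(w) commutes with i. By the reproducing property the Berezin value is a real multiple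
  of X.\<close>

lemma kernel_coefficient_commutes:
  assumes T: "T \<in> bounded_ops_J \<alpha> i" and w: "norm w < 1"
  shows "ip (nkern w) (T (nkern w)) * slice_emb i c = slice_emb i c * ip (nkern w) (T (nkern w))"
proof -
  define X where "X = T (nkern w) (slice_emb i w)"
  have lin: "bounded_right_linear \<alpha> i T" and J: "T (opJ i (nkern w)) = opJ i (T (nkern w))"
    using T nkern_in_space[OF w] by (auto simp: bounded_ops_J_def)
  note S = bergman_spaceD(1)[OF nkern_in_space[OF w]]
  have "opJ i (nkern w) = (\<lambda>x. nkern w x * i)"
  proof (rule slice_hyp_functions_eqI)
    fix z :: complex assume z: "norm z < 1"
    have "nkern w (slice_emb i z) * i = i * nkern w (slice_emb i z)"
      unfolding nkern_eq[OF w] kern_slice_emb[OF z]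
      using slice_emb_commute[of _ \<i>] by (simp add: of_real_def)
    then show "opJ i (nkern w) (slice_emb i z) = nkern w (slice_emb i z) * i"
      by (simp add: opJ_slice_emb[OF S z])
  qed (intro opJ_in slice_hyp_functions_mult_right S)+
  then have "(\<lambda>x. T (nkern w) x * i) = opJ i (T (nkern w))"
    using J bounded_right_linearD(3)[OF lin nkern_in_space[OF w], of i] by simp
  then have "X * i = i * X"
    using opJ_slice_emb[OF bergman_spaceD(1)[OF bounded_right_linearD(1)[OF lin nkern_in_space[OF w]]] w]
    unfolding X_def by metis
  moreover have "ip (nkern w) (T (nkern w)) = inverse (nrm (kern w)) *\<^sub>R X"
    unfolding ip_nkern[OF w bounded_right_linearD(1)[OF lin nkern_in_space[OF w]]] X_def
    by (rule quat_of_real_mult)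
  ultimately show ?thesis
    by (simp only: slice_emb_eq) (simp add: algebra_simps)
qed

text \<open>Young's inequality with weights 1/s and 1 - 1/s, applied to (1 - t) powr s and
  1.\<close>

lemma Bernoulli_powr:
  fixes t s :: real
  assumes "t < 1" "1 \<le> s"
  shows "1 - (1 - t) powr s \<le> s * t"
proof -
  have "((1 - t) powr s) powr (1 / s) * 1 powr (1 - 1 / s) \<le> 1 / s * (1 - t) powr s + (1 - 1 / s) * 1"
    using assms by (intro Youngs_inequality_0) auto
  then have "1 - t \<le> ((1 - t) powr s + (s - 1)) / s"
    using assms by (simp add: powr_powr add_divide_distrib diff_divide_distrib)
  then have "(1 - t) * s \<le> (1 - t) powr s + (s - 1)"
    using assms pos_le_divide_eq[of s "1 - t"] by simp
  then show ?thesis by (simp add: algebra_simps)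
qed

text \<open>Polarization: \<open>\<langle>x, Tx\<rangle> - \<langle>y, Ty\<rangle> = (\<langle>x - y, T(x + y)\<rangle> + \<langle>x + y, T(x - y)\<rangle>) / 2\<close>.\<close>

lemma berezin_lipschitz:
  assumes T: "T \<in> bounded_ops_J \<alpha> i" and z: "norm z < 1" and w: "norm w < 1"
  shows "norm (berezin \<alpha> i T (slice_emb i z) - berezin \<alpha> i T (slice_emb i w))
    \<le> 2 * sqrt (2 + \<alpha>) * operator_norm \<alpha> i T * (norm (z - w) / norm (1 - z * cnj w))"
proof -
  define N where "N = operator_norm \<alpha> i T"
  define \<rho> where "\<rho> = norm (z - w) / norm (1 - z * cnj w)"
  have lin: "bounded_right_linear \<alpha> i T" using T by (simp add: bounded_ops_J_def)
  note TD = bounded_right_linearD[OF lin]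
  obtain \<gamma> where \<gamma>: "ip (nkern z) (nkern w) = slice_emb i \<gamma>" "\<gamma> \<noteq> 0"
    "(norm \<gamma>)\<^sup>2 = (1 - \<rho>\<^sup>2) powr (\<alpha> + 2)" "\<rho>\<^sup>2 < 1"
    using ip_nkern_nkern[OF z w] unfolding \<rho>_def by blast
  \<comment> \<open>The unit phase that turns \<gamma> into |\<gamma>| when it acts from the right
    on k_w.\<close>
  define q where "q = slice_emb i (cnj \<gamma> / of_real (norm \<gamma>))"
  have nq: "norm q = 1" using \<gamma>(2) by (simp add: q_def norm_divide)
  then have qq: "qcnj q * q = 1" by (simp add: qcnj_mult_self)
  define x where "x = nkern z"
  define y where "y = (\<lambda>p. nkern w p * q)"
  have xH: "x \<in> H" and yH: "y \<in> H"
    using z w by (simp_all add: x_def y_def nkern_in_space bergman_space_mult_right)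
  have nx: "nrm x = 1" and ny: "nrm y = 1"
    using z w by (simp_all add: x_def y_def nrm_nkern nrm_mult nkern_in_space nq)
  have "\<gamma> * (cnj \<gamma> / of_real (norm \<gamma>)) = of_real (norm \<gamma>)"
    using \<gamma>(2) by (simp add: field_simps flip: complex_norm_square) (simp add: power2_eq_square)
  then have xy: "ip x y = of_real (norm \<gamma>)"
    using z w by (simp add: x_def y_def ip_mult_right nkern_in_space \<gamma>(1) q_def flip: slice_emb_mult)
  \<comment> \<open>The rotation conjugates the Berezin value by q, which lies in the slice and
    therefore commutes with it.\<close>
  have By: "ip y (T y) = berezin \<alpha> i T (slice_emb i w)"
  proof -
    have "ip y (T y) = qcnj q * (ip (nkern w) (T (nkern w)) * q)"
      using w by (simp add: y_def TD ip_mult_left ip_mult_right nkern_in_space bergman_space_mult_right)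
    also have "\<dots> = (qcnj q * q) * ip (nkern w) (T (nkern w))"
      using kernel_coefficient_commutes[OF T w] by (simp add: q_def mult.assoc)
    finally show ?thesis by (simp add: qq berezin_def)
  qed
  have Bx: "ip x (T x) = berezin \<alpha> i T (slice_emb i z)"
    by (simp add: x_def berezin_def)
  define s d where "s = (\<lambda>p. x p + y p)" and "d = (\<lambda>p. x p - y p)"
  have sH: "s \<in> H" and dH: "d \<in> H"
    using xH yH by (simp_all add: s_def d_def bergman_space_add bergman_space_diff)
  have "ip d (T s) + ip s (T d) = 2 * (ip x (T x) - ip y (T y))"
    using xH yH TD(1) bounded_right_linear_diff[OF lin xH yH]
    by (simp add: s_def d_def TD(2) ip_add_left ip_add_right ip_diff_left ip_diff_right
        bergman_space_add bergman_space_diff algebra_simps mult_2)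
  then have "2 * norm (ip x (T x) - ip y (T y)) = norm (ip d (T s) + ip s (T d))"
    by (simp only: norm_mult norm_numeral)
  also have "\<dots> \<le> norm (ip d (T s)) + norm (ip s (T d))" by (rule norm_triangle_ineq)
  also have "\<dots> \<le> nrm d * (N * nrm s) + nrm s * (N * nrm d)"
    unfolding N_def using sH dH TD(1) operator_norm_bound[OF lin]
    by (intro add_mono order_trans[OF ip_cauchy_schwarz] mult_left_mono) auto
  finally have "norm (ip x (T x) - ip y (T y)) \<le> N * (nrm d * nrm s)" by simp
  \<comment> \<open>Since <x, y> = |\<gamma>| is real, the left side equals 4 (1 - |\<gamma>|^2).
    Bernoulli with exponent \<alpha> + 2 > 1 then bounds it by a multiple of \<rho>^2, and this is
    the origin of the constant.\<close>
  moreover have "(nrm d * nrm s)\<^sup>2 \<le> (2 * (sqrt (2 + \<alpha>) * \<rho>))\<^sup>2"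
  proof -
    have "(nrm d)\<^sup>2 = 2 - 2 * norm \<gamma>" "(nrm s)\<^sup>2 = 2 + 2 * norm \<gamma>"
      using nrm_add_sq[OF xH yH] by (simp_all add: s_def d_def nx ny xy)
    then have "(nrm d * nrm s)\<^sup>2 = 4 * (1 - (norm \<gamma>)\<^sup>2)"
      by (simp add: power_mult_distrib) (simp add: power2_eq_square algebra_simps)
    also have "\<dots> \<le> 4 * ((\<alpha> + 2) * \<rho>\<^sup>2)"
      unfolding \<gamma>(3) using Bernoulli_powr[OF \<gamma>(4), of "\<alpha> + 2"] alpha by simp
    also have "\<dots> = (2 * (sqrt (2 + \<alpha>) * \<rho>))\<^sup>2"
      using alpha by (simp add: power_mult_distrib add.commute)
    finally show ?thesis .
  qed
  then have "nrm d * nrm s \<le> 2 * (sqrt (2 + \<alpha>) * \<rho>)"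
    by (rule power2_le_imp_le) (use alpha in \<open>simp add: \<rho>_def\<close>)
  moreover have "0 \<le> N"
    using operator_norm_bound[OF lin xH] nrm_nonneg[OF TD(1)[OF xH]] by (simp add: nx N_def)
  ultimately have "norm (ip x (T x) - ip y (T y)) \<le> N * (2 * (sqrt (2 + \<alpha>) * \<rho>))"
    by (meson mult_left_mono order_trans)
  then show ?thesis by (simp add: Bx By N_def \<rho>_def mult_ac)
qed

section \<open>The extremal operator\<close>

definition coord :: "quat \<Rightarrow> quat" where
  "coord = qext i (\<lambda>z. slice_emb i (of_real (sqrt (\<alpha> + 2)) * z))"

text \<open>Exchanges the orthonormal vectors \<open>kern 0\<close>, which is the constant 1 on the
  ball, and \<open>coord\<close>, and vanishes on their orthogonal complement. The coefficients
  stand on the right to keep it right linear.\<close>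

definition flip_op :: qoperator where
  "flip_op f = (\<lambda>x. kern 0 x * ip coord f + coord x * ip (kern 0) f)"

lemma slice_hyp_zero_off_disc:
  assumes "f \<in> slice_hyp_functions" "\<not> norm z < 1"
  shows "f (slice_emb i z) = 0"
  using assms by (auto simp: slice_hyp_functions_def qDisc_def)

lemma coord_slice_emb: "norm z < 1 \<Longrightarrow> coord (slice_emb i z) = slice_emb i (of_real (sqrt (\<alpha> + 2)) * z)"
  by (simp add: coord_def qext_slice_emb)

lemma norm_coord_slice_emb: 
  assumes "norm z < 1"
  shows "(norm (coord (slice_emb i z)))\<^sup>2 = (\<alpha> + 2) * (norm z)\<^sup>2 ^ 1"
  using assms alpha by (simp add: coord_slice_emb norm_mult power_mult_distrib)

lemma coord_in_space: "coord \<in> H"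
  unfolding bergman_space_iff
proof
  show S: "coord \<in> slice_hyp_functions"
    unfolding coord_def
    by (intro qext_in_slice_hyp_functions left_holomorphic_slice_emb holomorphic_intros)
  note [measurable] = slice_hyp_emb_measurable[OF S]
  show "integrable \<mu> (\<lambda>z. (norm (coord (slice_emb i z)))\<^sup>2)"
  proof (rule integrable_disc_bounded[OF alpha])
    show "(\<lambda>z. (norm (coord (slice_emb i z)))\<^sup>2) \<in> borel_measurable borel" by measurable
    fix z :: complex assume z: "norm z < 1"
    then have "(norm z)\<^sup>2 \<le> 1" by (simp add: power_le_one)
    then show "norm ((norm (coord (slice_emb i z)))\<^sup>2) \<le> \<alpha> + 2"
      unfolding norm_coord_slice_emb[OF z] using alpha
      by (simp add: abs_mult mult_left_le)
  qed
qed

text \<open>The integral of |z|^2 is 1 / (\<alpha> + 2), which explains the factor sqrt (\<alpha> +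
  2) in \<open>coord\<close>.\<close>

lemma nrm_coord: "nrm coord = 1"
proof -
  note [measurable] = bergman_spaceD(3)[OF coord_in_space]
  have "(nrm coord)\<^sup>2 = (\<integral>z. (\<alpha> + 2) * (norm z)\<^sup>2 ^ 1 \<partial>\<mu>)"
    unfolding nrm_sq[OF coord_in_space]
  proof (rule integral_cong_AE)
    show "AE z in \<mu>. (norm (coord (slice_emb i z)))\<^sup>2 = (\<alpha> + 2) * (norm z)\<^sup>2 ^ 1"
      by (rule eventually_mono[OF AE_disc_measure]) (rule norm_coord_slice_emb)
  qed measurable
  also have "\<dots> = (\<alpha> + 2) * (fact 1 / pochhammer (\<alpha> + 2) 1)"
    by (simp only: integral_mult_right_zero integral_disc_measure_power[OF alpha])
  also have "\<dots> = 1" using alpha by simp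
  finally have "(nrm coord)\<^sup>2 = 1\<^sup>2" by simp
  then show ?thesis
    by (rule power2_eq_imp_eq) (simp_all add: coord_in_space)
qed

lemma kern_0_slice_emb: "norm z < 1 \<Longrightarrow> kern 0 (slice_emb i z) = 1"
  by (simp add: kern_slice_emb)

lemma kern_0_in_space: "kern 0 \<in> H"
  by (simp add: kern_in_space)

lemma nrm_kern_0: "nrm (kern 0) = 1"
proof -
  have "(nrm (kern 0))\<^sup>2 = 1\<^sup>2" using nrm_kern_sq[of 0] by simp
  then show ?thesis
    by (rule power2_eq_imp_eq) (simp_all add: kern_0_in_space)
qed

lemma ip_kern_0: "f \<in> H \<Longrightarrow> ip (kern 0) f = f 0"
  using kern_reproducing[of 0 f] by simp

lemma coord_0: "coord 0 = 0"
  using coord_slice_emb[of 0] by simp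

text \<open>Pythagoras: pairing with \<open>kern 0\<close> is evaluation at the origin, where
  \<open>coord\<close> vanishes.\<close>

lemma nrm_flip_plane: "(nrm (\<lambda>x. kern 0 x * a + coord x * b))\<^sup>2 = (norm a)\<^sup>2 + (norm b)\<^sup>2"
proof -
  have "ip (\<lambda>x. kern 0 x * a) (\<lambda>x. coord x * b) = 0"
    by (simp add: ip_mult_left ip_mult_right kern_0_in_space coord_in_space bergman_space_mult_right
        ip_kern_0 coord_0)
  then show ?thesis
    by (simp add: nrm_add_sq(1) bergman_space_mult_right kern_0_in_space coord_in_space nrm_mult
        nrm_kern_0 nrm_coord)
qed

lemma flip_plane_in_space: "(\<lambda>x. kern 0 x * a + coord x * b) \<in> H"
  by (intro bergman_space_add bergman_space_mult_right kern_0_in_space coord_in_space)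

text \<open>Bessel's inequality in disguise. P is the orthogonal projection of f to the plane, and
  \<open>flip_op f\<close> has the same norm \<open>sqrt n\<close> because the swap only exchanges
  the coefficients. As <P, f> = n, Cauchy-Schwarz gives n \<le> sqrt n |f|.\<close>

lemma flip_op_contraction:
  assumes f: "f \<in> H"
  shows "nrm (flip_op f) \<le> nrm f"
proof -
  define a b where "a = ip coord f" and "b = ip (kern 0) f"
  define n where "n = (norm a)\<^sup>2 + (norm b)\<^sup>2"
  have n: "0 \<le> n" by (simp add: n_def)
  define P where "P = (\<lambda>x. kern 0 x * b + coord x * a)"
  have PH: "P \<in> H" unfolding P_def by (rule flip_plane_in_space)
  have nP: "nrm P = sqrt n"
    by (rule real_sqrt_unique[symmetric]) (simp_all only: P_def nrm_flip_plane n_def nrm_nonneg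
      flip_plane_in_space add.commute[of "(norm b)\<^sup>2"])
  have nT: "nrm (flip_op f) = sqrt n"
    by (rule real_sqrt_unique[symmetric])
      (simp_all only: flip_op_def nrm_flip_plane n_def a_def b_def nrm_nonneg flip_plane_in_space)
  have "ip P f = qcnj b * b + qcnj a * a"
    unfolding P_def using f
    by (simp add: ip_add_left ip_mult_left bergman_space_mult_right kern_0_in_space coord_in_space a_def b_def)
  then have "ip P f = of_real n" by (simp add: qcnj_mult_self n_def)
  then have le: "n \<le> sqrt n * nrm f"
    using ip_cauchy_schwarz[OF PH f] n by (simp add: nP)
  have "sqrt n \<le> nrm f"
  proof (cases "n = 0")
    case False
    have "sqrt n * sqrt n \<le> sqrt n * nrm f" using le n by simp
    then show ?thesis by (rule mult_left_le_imp_le) (use False n in simp)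
  qed (simp add: f)
  then show ?thesis by (simp add: nT)
qed

text \<open>The second part holds for every z because both sides vanish off the disc; integrands may
  therefore be rewritten everywhere and not just almost everywhere.\<close>

lemma opJ_in_space: "f \<in> H \<Longrightarrow> opJ i f \<in> H"
  and opJ_emb: "f \<in> H \<Longrightarrow> opJ i f (slice_emb i z) = i * f (slice_emb i z)"
proof -
  assume f: "f \<in> H"
  note S = bergman_spaceD(1)[OF f]
  show *: "opJ i f (slice_emb i z) = i * f (slice_emb i z)" for z
    using opJ_slice_emb[OF S, of z] slice_hyp_zero_off_disc[OF S, of z]
      slice_hyp_zero_off_disc[OF opJ_in[OF S], of z] by (cases "norm z < 1") auto
  show "opJ i f \<in> H"
    using bergman_spaceD(2)[OF f] by (simp add: bergman_space_iff opJ_in[OF S] * norm_mult)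
qed

lemma ip_coord_opJ:
  assumes f: "f \<in> H"
  shows "ip coord (opJ i f) = i * ip coord f"
proof -
  have "qcnj (coord (slice_emb i z)) * (i * f (slice_emb i z)) = i * (qcnj (coord (slice_emb i z)) * f (slice_emb i z))" for z
  proof (cases "norm z < 1")
    case True
    have "qcnj (coord (slice_emb i z)) * i = i * qcnj (coord (slice_emb i z))"
      unfolding coord_slice_emb[OF True] slice_emb_cnj[symmetric] using slice_emb_commute[of _ \<i>] by simp
    then show ?thesis by (simp flip: mult.assoc)
  next
    case False
    then show ?thesis using slice_hyp_zero_off_disc[OF bergman_spaceD(1)[OF f]] by simp
  qed
  then show ?thesis
    using f by (simp add: bergman_inner_eq coord_in_space opJ_in_space opJ_emb bergman_inner_integrable)
qed

text \<open>Commutation with J rests on \<open>kern 0\<close> and \<open>coord\<close> having values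
  in the slice on the slice disc: the i that J produces in each coefficient can be moved to the left
  through them.\<close>

lemma flip_op_bounded_ops_J: "flip_op \<in> bounded_ops_J \<alpha> i"
proof -
  have "bounded_right_linear \<alpha> i flip_op"
    unfolding bounded_right_linear_def
  proof (intro conjI ballI allI exI[of _ 1])
    show "flip_op f \<in> H" for f unfolding flip_op_def by (rule flip_plane_in_space)
    show "flip_op (\<lambda>x. f x + g x) = (\<lambda>x. flip_op f x + flip_op g x)" if "f \<in> H" "g \<in> H" for f g
      using that by (simp add: flip_op_def fun_eq_iff ip_add_right coord_in_space kern_0_in_space algebra_simps)
    show "flip_op (\<lambda>x. f x * q) = (\<lambda>x. flip_op f x * q)" if "f \<in> H" for f q
      using that by (simp add: flip_op_def fun_eq_iff ip_mult_right coord_in_space kern_0_in_space algebra_simps)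
    show "nrm (flip_op f) \<le> 1 * nrm f" if "f \<in> H" for f
      using flip_op_contraction[OF that] by simp
  qed
  moreover have "flip_op (opJ i f) = opJ i (flip_op f)" if f: "f \<in> H" for f
  proof (rule slice_hyp_functions_eqI)
    have F: "flip_op f \<in> H" for f unfolding flip_op_def by (rule flip_plane_in_space)
    show "flip_op (opJ i f) \<in> slice_hyp_functions" "opJ i (flip_op f) \<in> slice_hyp_functions"
      using F bergman_spaceD(1) opJ_in by auto
    fix z :: complex assume z: "norm z < 1"
    have c: "coord (slice_emb i z) * i = i * coord (slice_emb i z)"
      unfolding coord_slice_emb[OF z] using slice_emb_commute[of _ \<i>] by simp
    have f0: "opJ i f 0 = i * f 0" using opJ_emb[OF f, of 0] by simp
    have "flip_op (opJ i f) (slice_emb i z) = i * ip coord f + (coord (slice_emb i z) * i) * f 0"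
      by (simp add: flip_op_def kern_0_slice_emb z ip_coord_opJ f ip_kern_0 opJ_in_space f0 mult.assoc)
    also have "\<dots> = i * flip_op f (slice_emb i z)"
      unfolding c by (simp add: flip_op_def kern_0_slice_emb z ip_kern_0 f algebra_simps)
    finally show "flip_op (opJ i f) (slice_emb i z) = opJ i (flip_op f) (slice_emb i z)"
      by (simp add: opJ_emb F)
  qed
  ultimately show ?thesis by (simp add: bounded_ops_J_def)
qed

text \<open>Up to the factor c, the value is \<open>flip_op\<close> applied to k_r and evaluated at
  r. Its two summands, \<open>kern 0\<close> times <coord, k_r> and \<open>coord\<close> times
  k_r(0), are equal at r, whence the 2; the power of 1 - r^2 is c^2.\<close>

lemma berezin_flip_op:
  assumes r: "0 \<le> r" "r < 1"
  shows "berezin \<alpha> i flip_op (of_real r) = of_real (2 * sqrt (\<alpha> + 2) * r * (1 - r\<^sup>2) powr (\<alpha> + 2))"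
proof -
  define c where "c = inverse (nrm (kern (of_real r)))"
  have nr: "norm (complex_of_real r) < 1" using r by simp
  note k = nkern_in_space[OF nr]
  have "kern (of_real r) 0 = 1"
    using kern_slice_emb[of 0 "of_real r"] by simp
  then have k0: "nkern (of_real r) 0 = of_real c"
    using nkern_eq[OF nr] by (simp add: c_def)
  have cr: "coord (of_real r) = of_real (sqrt (\<alpha> + 2) * r)"
    using coord_slice_emb[OF nr] by (simp flip: of_real_mult)
  have kr: "kern 0 (of_real r) = 1"
    using kern_0_slice_emb[OF nr] by simp
  have "ip (nkern (of_real r)) coord = of_real (c * (sqrt (\<alpha> + 2) * r))"
    using ip_nkern[OF nr coord_in_space] by (simp add: cr c_def)
  then have ce: "ip coord (nkern (of_real r)) = of_real (c * (sqrt (\<alpha> + 2) * r))"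
    using ip_cnj[OF k coord_in_space] by (simp del: of_real_mult)
  have "flip_op (nkern (of_real r)) \<in> H" unfolding flip_op_def by (rule flip_plane_in_space)
  then have "berezin \<alpha> i flip_op (of_real r) = of_real c * flip_op (nkern (of_real r)) (of_real r)"
    using ip_nkern[OF nr] by (simp add: berezin_def c_def)
  also have "\<dots> = of_real (2 * sqrt (\<alpha> + 2) * r * c\<^sup>2)"
    unfolding flip_op_def ce kr cr ip_kern_0[OF k] k0
    by (simp add: power2_eq_square distrib_left mult_ac flip: of_real_mult of_real_add)
  also have "c\<^sup>2 = (1 - r\<^sup>2) powr (\<alpha> + 2)"
    using nrm_kern_sq[OF nr] by (simp add: c_def power_inverse powr_minus)
      (metis inverse_inverse_eq powr_minus minus_add_distrib uminus_add_conv_diff add.commute diff_conv_add_uminus)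
  finally show ?thesis .
qed

text \<open>The points r and 0 have \<rho> = r. After division by r, letting r decrease to 0 leaves
  the slope 2 sqrt (2 + \<alpha>) of the Berezin transform at the origin, whereas the operator norm
  is at most 1.\<close>

lemma berezin_lipschitz_sharp:
  assumes C: "C < 2 * sqrt (2 + \<alpha>)"
    and bound: "\<And>z w. norm z < 1 \<Longrightarrow> norm w < 1 \<Longrightarrow>
      norm (berezin \<alpha> i flip_op (slice_emb i z) - berezin \<alpha> i flip_op (slice_emb i w))
        \<le> C * operator_norm \<alpha> i flip_op * (norm (z - w) / norm (1 - z * cnj w))"
  shows False
proof -
  define N where "N = operator_norm \<alpha> i flip_op"
  have lin: "bounded_right_linear \<alpha> i flip_op"
    using flip_op_bounded_ops_J by (simp add: bounded_ops_J_def)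
  have "0 \<le> N"
    using operator_norm_bound[OF lin kern_0_in_space] nrm_nonneg[OF bounded_right_linearD(1)[OF lin kern_0_in_space]]
    by (simp add: nrm_kern_0 N_def)
  have "N \<le> 1"
    unfolding N_def by (rule operator_norm_le) (auto intro: flip_op_contraction)
  \<comment> \<open>Only 0 \<le> N \<le> 1 is available, so for negative C the bound C N \<le> C
    could fail. Replacing C by \<open>max C 0\<close> is harmless, since this is still below the
    positive number 2 sqrt (2 + \<alpha>).\<close>
  have CN: "C * N \<le> max C 0"
  proof -
    have "C * N \<le> max C 0 * N" using \<open>0 \<le> N\<close> by (intro mult_right_mono) auto
    also have "\<dots> \<le> max C 0 * 1" using \<open>N \<le> 1\<close> by (intro mult_left_mono) auto
    finally show ?thesis by simp
  qed
  have le: "2 * sqrt (\<alpha> + 2) * (1 - r\<^sup>2) powr (\<alpha> + 2) \<le> max C 0" if r: "0 < r" "r < 1" for r :: real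
  proof -
    have "norm (berezin \<alpha> i flip_op (of_real r) - berezin \<alpha> i flip_op (of_real 0)) \<le> C * N * r"
      using bound[of "of_real r" 0] r by (simp add: N_def)
    moreover have "berezin \<alpha> i flip_op (of_real r) - berezin \<alpha> i flip_op (of_real 0)
      = of_real (2 * sqrt (\<alpha> + 2) * r * (1 - r\<^sup>2) powr (\<alpha> + 2))"
      using r by (simp only: berezin_flip_op less_imp_le) (simp add: berezin_flip_op[of 0, simplified])
    ultimately have "2 * sqrt (\<alpha> + 2) * r * (1 - r\<^sup>2) powr (\<alpha> + 2) \<le> C * N * r"
      using r alpha by (simp del: of_real_mult)
    also have "\<dots> \<le> max C 0 * r" using CN r by (intro mult_right_mono) auto
    finally show ?thesis using r by (simp add: mult_ac)
  qed
  have "((\<lambda>r::real. 2 * sqrt (\<alpha> + 2) * (1 - r\<^sup>2) powr (\<alpha> + 2)) \<longlongrightarrow> 2 * sqrt (\<alpha> + 2) * (1 - 0\<^sup>2) powr (\<alpha> + 2)) (at_right 0)"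
    by (intro tendsto_intros) auto
  moreover have "\<forall>\<^sub>F r in at_right (0::real). 2 * sqrt (\<alpha> + 2) * (1 - r\<^sup>2) powr (\<alpha> + 2) \<le> max C 0"
    by (rule eventually_mono[OF eventually_at_right_real[of 0 1]]) (auto intro!: le)
  ultimately have "2 * sqrt (\<alpha> + 2) * (1 - 0\<^sup>2) powr (\<alpha> + 2) \<le> max C 0"
    by (rule tendsto_upperbound) simp
  moreover have "0 < sqrt (2 + \<alpha>)" using alpha by simp
  ultimately show False using C by (simp add: add.commute max_def split: if_splits)
qed

end

section \<open>Transfer of both bounds to points of the slice disc\<close>

theorem theorem5p19:
  fixes \<alpha> :: real and i :: quat
  assumes "\<alpha> > -1" and "i \<in> qSphere"
  shows "(\<forall>T\<in>bounded_ops_J \<alpha> i. \<forall>z\<in>slice_disc i. \<forall>w\<in>slice_disc i.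
            norm (berezin \<alpha> i T z - berezin \<alpha> i T w)
              \<le> 2 * sqrt (2 + \<alpha>) * operator_norm \<alpha> i T * pseudo_hyp_dist z w) \<and>
         \<not> (\<exists>C < 2 * sqrt (2 + \<alpha>).
            \<forall>T\<in>bounded_ops_J \<alpha> i. \<forall>z\<in>slice_disc i. \<forall>w\<in>slice_disc i.
              norm (berezin \<alpha> i T z - berezin \<alpha> i T w)
                \<le> C * operator_norm \<alpha> i T * pseudo_hyp_dist z w)"
proof -
  interpret bergman i \<alpha> by unfold_locales (use assms in auto)
  show ?thesis
  proof (intro conjI ballI notI)
    fix T z w assume "T \<in> bounded_ops_J \<alpha> i" "z \<in> slice_disc i" "w \<in> slice_disc i"
    then obtain z' w' where T: "T \<in> bounded_ops_J \<alpha> i"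
      and "norm z' < 1" "norm w' < 1" and [simp]: "z = slice_emb i z'" "w = slice_emb i w'"
      by (auto simp: slice_disc_eq)
    then show "norm (berezin \<alpha> i T z - berezin \<alpha> i T w)
              \<le> 2 * sqrt (2 + \<alpha>) * operator_norm \<alpha> i T * pseudo_hyp_dist z w"
      using berezin_lipschitz[OF T, of z' w'] by (simp only: pseudo_hyp_dist_emb)
  next
    assume "\<exists>C < 2 * sqrt (2 + \<alpha>).
            \<forall>T\<in>bounded_ops_J \<alpha> i. \<forall>z\<in>slice_disc i. \<forall>w\<in>slice_disc i.
              norm (berezin \<alpha> i T z - berezin \<alpha> i T w)
                \<le> C * operator_norm \<alpha> i T * pseudo_hyp_dist z w"
    then obtain C where C: "C < 2 * sqrt (2 + \<alpha>)" and
      le: "\<And>z w. z \<in> slice_disc i \<Longrightarrow> w \<in> slice_disc i \<Longrightarrow>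
        norm (berezin \<alpha> i flip_op z - berezin \<alpha> i flip_op w)
                \<le> C * operator_norm \<alpha> i flip_op * pseudo_hyp_dist z w"
      using flip_op_bounded_ops_J by blast
    show False
      by (rule berezin_lipschitz_sharp[OF C])
        (use le[of "slice_emb i _" "slice_emb i _"] in \<open>simp add: slice_emb_in_slice_disc pseudo_hyp_dist_emb\<close>)
  qed
qed

end
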